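(* Let $d\ge1$, $S=[-1,1]^d$, and for $n\in\mathbb{N}$ let $\nu_n=\frac{1}{n+1}\sum_{i=1}^{n+1}\delta_{x_i}$ with $x_i=\cos\!\left(\frac{2i-1}{2(n+1)}\pi\right)\in(-1,1)$, $i=1,\dots,n+1$, be the (univariate) Gauss–Chebyshev atomic measure. Then the multivariate atomic product measure $\nu^\star_n:=\nu_n\otimes\cdots\otimes\nu_n$ ($d$ times) on $S$ is an optimal solution of $$\max_{\phi\in\mathscr{P}(S)}\ \sum_{g\in G^{\square}_n}\log\det\mathbf{M}_{n-d_g}(g\,\phi).$$ Moreover, as $n\to\infty$, $\nu^\star_n$ converges in the weak-star topology to the equilibrium measure $\phi^\star=\dfrac{d\mathbf{x}}{\pi^d\sqrt{(1-x_1^2)\cdots(1-x_d^2)}}$ of $S$, i.e. $\int_S f\,d\nu^\star_n\to\int_S f\,d\phi^\star$ for every continuous $f:S\to\mathbb{R}$.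
   Context: $\mathscr{P}(S)$ is the set of Borel probability measures on $S$. $G^{\square}_n=\{\prod_{j=1}^d(1-x_j^2)^{\varepsilon_j}:\boldsymbol{\varepsilon}\in\{0,1\}^d,\ |\boldsymbol{\varepsilon}|=\sum_j\varepsilon_j\le n\}$. For a polynomial $g$, $d_g=\lceil\deg(g)/2\rceil$. For $k\in\mathbb{N}$, $\mathbf{v}_k(\mathbf{x})=(\mathbf{x}^{\boldsymbol{\alpha}})_{|\boldsymbol{\alpha}|\le k}$ is the vector of all monomials in $x_1,\dots,x_d$ of total degree at most $k$, and for a measure $\phi$ on $S$ and a polynomial $g$, $\mathbf{M}_k(g\,\phi)=\int_S\mathbf{v}_k(\mathbf{x})\mathbf{v}_k(\mathbf{x})^T g(\mathbf{x})\,d\phi(\mathbf{x})$. Convention: $\log\det\mathbf{X}=-\infty$ for singular $\mathbf{X}\succeq0$. *)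

theory Defs
  imports
    "HOL-Probability.Probability"
    "HOL-Library.Poly_Mapping"
    "Jordan_Normal_Form.Determinant"
begin

(* Avoid the clash with vec_nth; matrices and vectors of Jordan_Normal_Form are used below only
   because the size of a moment matrix varies with the degree. *)
no_notation vec_index (infixl "$" 100)

section \<open>Polynomials in the variables indexed by a finite type\<close>

text \<open>Multi-indices are finitely supported functions into the naturals, so that a polynomial is an
  element of the monoid algebra provided by \<^theory>\<open>HOL-Library.Poly_Mapping\<close>.\<close>

type_synonym 'd multi_index = "'d \<Rightarrow>\<^sub>0 nat"
type_synonym 'd mpoly = "'d multi_index \<Rightarrow>\<^sub>0 real"

definition mi_degree :: "'d::finite multi_index \<Rightarrow> nat" where
  "mi_degree \<alpha> = (\<Sum>j\<in>UNIV. Poly_Mapping.lookup \<alpha> j)"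

definition monomial_at :: "'d::finite multi_index \<Rightarrow> real^'d \<Rightarrow> real" where
  "monomial_at \<alpha> x = (\<Prod>j\<in>UNIV. (x $ j) ^ Poly_Mapping.lookup \<alpha> j)"

definition Var :: "'d::finite \<Rightarrow> 'd mpoly" where
  "Var j = Poly_Mapping.single (Poly_Mapping.single j 1) 1"

definition total_degree :: "'d::finite mpoly \<Rightarrow> nat" where
  "total_degree p = Max (insert 0 (mi_degree ` Poly_Mapping.keys p))"

definition mpoly_eval :: "'d::finite mpoly \<Rightarrow> real^'d \<Rightarrow> real" where
  "mpoly_eval p x = (\<Sum>\<alpha>\<in>Poly_Mapping.keys p. Poly_Mapping.lookup p \<alpha> * monomial_at \<alpha> x)"

definition half_degree :: "'d::finite mpoly \<Rightarrow> nat" where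
  "half_degree g = nat \<lceil>real (total_degree g) / 2\<rceil>"

definition G_box :: "nat \<Rightarrow> 'd::finite mpoly set" where
  "G_box n = (\<lambda>\<epsilon>. \<Prod>j\<in>UNIV. (1 - Var j ^ 2) ^ \<epsilon> j) `
     {\<epsilon> :: 'd \<Rightarrow> nat. (\<forall>j. \<epsilon> j \<in> {0, 1}) \<and> (\<Sum>j\<in>UNIV. \<epsilon> j) \<le> n}"


section \<open>Moment matrices and the optimization problem\<close>

text \<open>The order in which the monomials are listed is arbitrary: changing it permutes the rows and
  columns of a moment matrix simultaneously, which leaves its determinant unchanged.\<close>

definition multi_indices :: "nat \<Rightarrow> 'd::finite multi_index list" where
  "multi_indices k = (SOME as. distinct as \<and> set as = {\<alpha>. mi_degree \<alpha> \<le> k})"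

lemma multi_indices:
  "distinct (multi_indices k :: 'd::finite multi_index list)"
  "set (multi_indices k :: 'd multi_index list) = {\<alpha>. mi_degree \<alpha> \<le> k}"
proof -
  let ?A = "{\<alpha> :: 'd multi_index. mi_degree \<alpha> \<le> k}"
  have "Poly_Mapping.lookup \<alpha> j \<le> k" if "\<alpha> \<in> ?A" for \<alpha> :: "'d multi_index" and j
    using member_le_sum[of j UNIV "Poly_Mapping.lookup \<alpha>"] that by (simp add: mi_degree_def)
  then have "Poly_Mapping.lookup ` ?A \<subseteq> Pi\<^sub>E UNIV (\<lambda>_. {..k})"
    by (intro subsetI) (auto simp: PiE_UNIV_domain)
  then have "finite (Poly_Mapping.lookup ` ?A)"
    by (rule finite_subset) (simp add: finite_PiE)
  then have "finite ?A"
    by (rule finite_imageD) (auto intro!: inj_onI poly_mapping_eqI)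
  then have "\<exists>as. distinct as \<and> set as = ?A"
    using finite_distinct_list by blast
  then have "distinct (multi_indices k :: 'd multi_index list) \<and> set (multi_indices k) = ?A"
    unfolding multi_indices_def by (rule someI_ex)
  then show "distinct (multi_indices k :: 'd multi_index list)"
    "set (multi_indices k :: 'd multi_index list) = ?A" by auto
qed

definition monomial_vec :: "nat \<Rightarrow> real^'d::finite \<Rightarrow> real Matrix.vec" where
  "monomial_vec k x = vec_of_list (map (\<lambda>\<alpha>. monomial_at \<alpha> x) (multi_indices k))"

definition moment_matrix ::
    "nat \<Rightarrow> 'd::finite mpoly \<Rightarrow> (real^'d) measure \<Rightarrow> real Matrix.mat" where
  "moment_matrix k g \<phi> =
     (let N = length (multi_indices k :: 'd multi_index list) in
      Matrix.mat N N (\<lambda>(r, c).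
        \<integral>x. vec_index (monomial_vec k x) r * vec_index (monomial_vec k x) c * mpoly_eval g x \<partial>\<phi>))"

text \<open>Only meant for positive semidefinite matrices.\<close>

definition log_det :: "real Matrix.mat \<Rightarrow> ereal" where
  "log_det X = (if Determinant.det X = 0 then -\<infinity> else ereal (ln (Determinant.det X)))"

definition cube :: "(real^'d::finite) set" where
  "cube = {x. \<forall>j. x $ j \<in> {-1..1}}"

definition borel_prob_measures :: "'a::topological_space set \<Rightarrow> 'a measure set" where
  "borel_prob_measures S = {\<phi>. prob_space \<phi> \<and> sets \<phi> = sets (restrict_space borel S)}"

definition logdet_objective :: "nat \<Rightarrow> (real^'d::finite) measure \<Rightarrow> ereal" where
  "logdet_objective n \<phi> = (\<Sum>g\<in>G_box n. log_det (moment_matrix (n - half_degree g) g \<phi>))"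


section \<open>The atomic measures and the equilibrium measure\<close>

definition chebyshev_node :: "nat \<Rightarrow> nat \<Rightarrow> real" where
  "chebyshev_node n i = cos ((2 * real i - 1) / (2 * (real n + 1)) * pi)"

text \<open>The push-forward of the uniform distribution on the indices is the average of the Dirac
  measures at the nodes; see \<open>emeasure_gauss_chebyshev\<close>.\<close>

definition gauss_chebyshev :: "nat \<Rightarrow> real measure" where
  "gauss_chebyshev n =
     distr (uniform_count_measure {1..n+1}) (restrict_space borel {-1..1}) (chebyshev_node n)"

text \<open>The library's product measure lives on functions; it is transported to \<open>real^'d\<close>.\<close>

definition gauss_chebyshev_prod :: "nat \<Rightarrow> (real^'d::finite) measure" where
  "gauss_chebyshev_prod n =
     distr (Pi\<^sub>M UNIV (\<lambda>_. gauss_chebyshev n)) (restrict_space borel cube) (\<lambda>x. \<chi> j. x j)"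

text \<open>The density takes the value 0 where some coordinate is 1 or -1, because division
  by 0 yields 0; this is a null set.\<close>

definition equilibrium_measure :: "(real^'d::finite) measure" where
  "equilibrium_measure = density (restrict_space lborel cube)
     (\<lambda>x. ennreal (1 / (pi ^ CARD('d) * sqrt (\<Prod>j\<in>UNIV. 1 - (x $ j)\<^sup>2))))"

lemma chebyshev_node_in: "chebyshev_node n i \<in> {-1..1}"
  by (simp add: chebyshev_node_def)

lemma measurable_chebyshev_node:
  "chebyshev_node n \<in> uniform_count_measure I \<rightarrow>\<^sub>M restrict_space borel {-1..1}"
  using chebyshev_node_in
  by (auto simp: measurable_def space_uniform_count_measure sets_uniform_count_measure
      space_restrict_space)

lemma emeasure_gauss_chebyshev:
  assumes "A \<in> sets (restrict_space borel {-1..1})"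
  shows "emeasure (gauss_chebyshev n) A =
    ennreal (1 / (real n + 1) * (\<Sum>i=1..n+1. indicator A (chebyshev_node n i)))"
proof -
  have "emeasure (gauss_chebyshev n) A =
      emeasure (uniform_count_measure {1..n+1}) (chebyshev_node n -` A \<inter> {1..n+1})"
    using assms measurable_chebyshev_node
    by (simp add: gauss_chebyshev_def emeasure_distr space_uniform_count_measure)
  also have "\<dots> = ennreal (real (card (chebyshev_node n -` A \<inter> {1..n+1})) / real (n + 1))"
    by (subst emeasure_uniform_count_measure) auto
  also have "real (card (chebyshev_node n -` A \<inter> {1..n+1})) =
      (\<Sum>i=1..n+1. indicator A (chebyshev_node n i))"
  proof -
    have "(\<Sum>i=1..n+1. indicator A (chebyshev_node n i) :: real) =
        (\<Sum>i\<in>{1..n+1}. if i \<in> chebyshev_node n -` A then 1 else 0)"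
      by (intro sum.cong) (simp_all add: indicator_def)
    also have "\<dots> = real (card (chebyshev_node n -` A \<inter> {1..n+1}))"
      by (subst sum.inter_restrict[symmetric]) (simp_all add: Int_commute)
    finally show ?thesis by simp
  qed
  finally show ?thesis by (simp add: field_simps)
qed

lemma gauss_chebyshev_prod_in:
  "(gauss_chebyshev_prod n :: (real^'d::finite) measure) \<in> borel_prob_measures cube"
proof -
  let ?P = "Pi\<^sub>M (UNIV :: 'd set) (\<lambda>_. gauss_chebyshev n)"
  have 1: "prob_space (gauss_chebyshev n)"
    unfolding gauss_chebyshev_def
    by (intro prob_space.prob_space_distr prob_space_uniform_count_measure
        measurable_chebyshev_node) auto
  interpret product_prob_space "\<lambda>_. gauss_chebyshev n" "UNIV :: 'd set"
    using 1 by (intro product_prob_spaceI)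
  have id: "(\<lambda>y. y) \<in> gauss_chebyshev n \<rightarrow>\<^sub>M borel"
    by (simp add: gauss_chebyshev_def measurable_restrict_space1
        cong: measurable_cong_sets)
  have comp: "(\<lambda>x. x j) \<in> borel_measurable ?P" for j
    using measurable_compose[OF measurable_component_singleton[of j UNIV] id] by simp
  have "(\<lambda>x. \<chi> j. x j) \<in> borel_measurable ?P"
    by (subst borel_measurable_euclidean_space)
       (auto simp: Basis_vec_def inner_axis intro!: borel_measurable_inner comp)
  then have "(\<lambda>x. \<chi> j. x j) \<in> ?P \<rightarrow>\<^sub>M restrict_space borel (cube :: (real^'d) set)"
    by (intro measurable_restrict_space2)
       (auto simp: cube_def space_PiM gauss_chebyshev_def space_restrict_space PiE_def Pi_def)
  then show ?thesis
    unfolding borel_prob_measures_def gauss_chebyshev_prod_def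
    by (auto intro: prob_space_distr)
qed

end

theory Submission
  imports Defs
begin

text \<open>
  Let \<open>w\<^sub>\<epsilon> = \<Prod>j. (1 - x\<^sub>j\<^sup>2)\<^sup>\<epsilon>\<^sub>j\<close> be the polynomials in \<open>G_box n\<close>, and for each of them let \<open>P\<^sub>\<epsilon>\<^sub>,\<^sub>\<alpha>\<close> with
  \<open>|\<alpha>| \<le> n - |\<epsilon>|\<close> be the products of normalized Chebyshev polynomials of the first kind (in the variables
  with \<open>\<epsilon>\<^sub>j = 0\<close>) and of the second kind (where \<open>\<epsilon>\<^sub>j = 1\<close>). Optimality rests on two facts about them.

  They are orthonormal with respect to \<open>w\<^sub>\<epsilon>\<close> times the Gauss-Chebyshev measure, because the sums
  of \<open>cos (m \<theta>\<^sub>i)\<close> over the angles of the nodes vanish for \<open>0 < m < 2 (n + 1)\<close>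
  (\<open>ortho_gram_gauss_chebyshev\<close>). And the sum of \<open>w\<^sub>\<epsilon> P\<^sub>\<epsilon>\<^sub>,\<^sub>\<alpha>\<^sup>2\<close> over all \<open>\<epsilon>\<close> and \<open>\<alpha>\<close> is constant on the cube, equal
  to the number of pairs \<open>(\<epsilon>, \<alpha>)\<close> (\<open>sum_ortho_squares\<close>): with \<open>x\<^sub>j = cos t\<^sub>j\<close> it splits into products of
  terms \<open>2 cos\<^sup>2 (b t\<^sub>j) + 2 sin\<^sup>2 (b t\<^sub>j) = 2\<close>.

  Expressing the moment matrices in the bases \<open>P\<^sub>\<epsilon>\<^sub>,\<^sub>\<alpha>\<close> changes each logarithmic determinant by a constant
  that does not depend on the measure (\<open>det_ortho_gram\<close>). In these bases the Gauss-Chebyshev measure yields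
  identity matrices, while a probability measure \<open>\<phi>\<close> yields positive semidefinite matrices \<open>A\<^sub>\<epsilon>\<close>, to
  which Hadamard's inequality and \<open>ln x \<le> x - 1\<close> apply: \<open>log det A\<^sub>\<epsilon> \<le> tr A\<^sub>\<epsilon> - dim A\<^sub>\<epsilon>\<close>
  (\<open>ln_det_le_trace\<close>). Integrating the constant sum of squares against \<open>\<phi>\<close> shows that the right-hand sides
  add up to 0 (\<open>sum_trace_excess\<close>), so \<open>\<phi>\<close> is not better than the Gauss-Chebyshev measure.

  The same cosine sums show that the atomic measure integrates polynomials of degree at most \<open>2 n + 1\<close> like the
  equilibrium measure (\<open>gauss_chebyshev_prod_exact\<close>), and polynomials are dense in the continuous functions
  on the cube; hence the weak-star limit.
\<close>


section \<open>Determinants of positive semidefinite matrices\<close>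

text \<open>Quadratic forms are written with coefficient functions on the naturals, so that the induction on the
size of the matrix below only has to shift indices.\<close>

definition psd :: "real mat \<Rightarrow> bool" where
  "psd A \<longleftrightarrow> (\<forall>f. 0 \<le> (\<Sum>i<dim_row A. \<Sum>j<dim_row A. f i * A $$ (i, j) * f j))"

lemma sum_mult_of_bool:
  fixes f :: "nat \<Rightarrow> real"
  assumes "i < n"
  shows "(\<Sum>j<n. f j * of_bool (j = i)) = f i"
proof -
  have "(\<Sum>j<n. f j * of_bool (j = i)) = (\<Sum>j<n. if j = i then f i else 0)"
    by (intro sum.cong) auto
  then show ?thesis using assms by simp
qed

lemma psd_diag:
  assumes "psd A" "i < dim_row A"
  shows "0 \<le> A $$ (i, i)"
proof -
  have "0 \<le> (\<Sum>k<dim_row A. \<Sum>j<dim_row A. of_bool (k = i) * A $$ (k, j) * of_bool (j = i))"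
    using assms(1) unfolding psd_def by (rule spec)
  also have "\<dots> = A $$ (i, i)"
    unfolding sum_mult_of_bool[OF assms(2)]
    using sum_mult_of_bool[OF assms(2), of "\<lambda>k. A $$ (k, i)"] by (simp only: mult.commute)
  finally show ?thesis .
qed

definition schur_complement :: "real mat \<Rightarrow> real mat" where
  "schur_complement A = Matrix.mat (dim_row A - 1) (dim_row A - 1)
     (\<lambda>(i, j). A $$ (Suc i, Suc j) - A $$ (Suc i, 0) * A $$ (0, Suc j) / A $$ (0, 0))"

text \<open>Adding multiples of the first column to the others, i.e. multiplying from the right by a unitriangular
matrix, clears the first row behind the pivot; what remains is block lower triangular.\<close>

lemma det_schur_complement:
  fixes A :: "real mat"
  assumes A: "A \<in> carrier_mat (Suc n) (Suc n)" and a: "A $$ (0, 0) \<noteq> 0"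
  shows "Determinant.det A = A $$ (0, 0) * Determinant.det (schur_complement A)"
proof -
  define R where "R = four_block_mat (1\<^sub>m 1)
    (Matrix.mat 1 n (\<lambda>(i, j). - A $$ (0, Suc j) / A $$ (0, 0))) (0\<^sub>m n 1) (1\<^sub>m n)"
  have R: "R \<in> carrier_mat (Suc n) (Suc n)"
    unfolding R_def by (intro carrier_matI) auto
  have detR: "Determinant.det R = 1"
    unfolding R_def by (subst det_four_block_mat_lower_left_zero[of _ 1 _ n]) auto
  have "A * R = four_block_mat (Matrix.mat 1 1 (\<lambda>_. A $$ (0, 0))) (0\<^sub>m 1 n)
      (Matrix.mat n 1 (\<lambda>(i, j). A $$ (Suc i, 0))) (schur_complement A)" (is "_ = ?B")
  proof (rule eq_matI)
    have dim: "dim_row ?B = Suc n" "dim_col ?B = Suc n"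
      using A by (auto simp: schur_complement_def)
    show "dim_row (A * R) = dim_row ?B" "dim_col (A * R) = dim_col ?B"
      using A R dim by auto
    fix i j assume ij: "i < dim_row ?B" "j < dim_col ?B"
    then have lt: "i < Suc n" "j < Suc n" using dim by auto
    have "(A * R) $$ (i, j) = (\<Sum>k<Suc n. A $$ (i, k) * R $$ (k, j))"
      using A R lt by (auto simp: scalar_prod_def atLeast0LessThan intro!: sum.cong)
    also have "\<dots> = A $$ (i, 0) * R $$ (0, j) + (\<Sum>k<n. A $$ (i, Suc k) * R $$ (Suc k, j))"
      by (rule sum.lessThan_Suc_shift)
    also have "(\<Sum>k<n. A $$ (i, Suc k) * R $$ (Suc k, j)) =
        (\<Sum>k<n. if Suc k = j then A $$ (i, j) else 0)"
      using lt unfolding R_def by (intro sum.cong refl) (auto split: nat.splits)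
    also have "\<dots> = (if j = 0 then 0 else A $$ (i, j))"
      using lt by (cases j) (auto simp: sum.delta)
    finally show "(A * R) $$ (i, j) = ?B $$ (i, j)"
      using lt A a unfolding R_def by (cases i; cases j) (auto simp: schur_complement_def)
  qed
  then have "Determinant.det A * Determinant.det R = Determinant.det ?B"
    using det_mult[OF A R] by simp
  also have "\<dots> = Determinant.det (Matrix.mat 1 1 (\<lambda>_. A $$ (0, 0))) *
      Determinant.det (schur_complement A)"
    using A by (intro det_four_block_mat_upper_right_zero[of _ 1 _ n])
      (auto simp: schur_complement_def)
  also have "Determinant.det (Matrix.mat 1 1 (\<lambda>_. A $$ (0, 0))) = A $$ (0, 0)"
    by (subst det_single) auto
  finally show ?thesis using detR by simp
qed

text \<open>The form of the Schur complement at \<open>f\<close> is the minimum of the form of \<open>A\<close> over all vectors that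
continue \<open>f\<close> by an additional first entry; the minimizing entry is \<open>- s / a\<close>.\<close>

lemma psd_schur_complement:
  assumes A: "A \<in> carrier_mat (Suc n) (Suc n)" and sym: "\<And>i j. i \<le> n \<Longrightarrow> j \<le> n \<Longrightarrow> A $$ (i, j) = A $$ (j, i)"
    and psd: "psd A" and a: "0 < A $$ (0, 0)"
  shows "psd (schur_complement A)"
  unfolding psd_def
proof
  fix f :: "nat \<Rightarrow> real"
  define a where "a = A $$ (0, 0)"
  define b where "b i = A $$ (Suc i, 0)" for i
  define s where "s = (\<Sum>i<n. f i * b i)"
  define g where "g i = (case i of 0 \<Rightarrow> - s / a | Suc k \<Rightarrow> f k)" for i
  define Q where "Q = (\<Sum>i<n. \<Sum>j<n. f i * A $$ (Suc i, Suc j) * f j)"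
  have b': "A $$ (0, Suc j) = b j" if "j < n" for j
    using sym[of 0 "Suc j"] that by (simp add: b_def)
  have "0 \<le> (\<Sum>i<Suc n. \<Sum>j<Suc n. g i * A $$ (i, j) * g j)"
    using psd A unfolding psd_def by auto
  also have "\<dots> = s / a * a * (s / a) - (\<Sum>j<n. s / a * b j * f j) +
      (\<Sum>i<n. - f i * b i * (s / a) + (\<Sum>j<n. f i * A $$ (Suc i, Suc j) * f j))"
    unfolding sum.lessThan_Suc_shift[of _ n]
    by (simp add: g_def b' a_def b_def sum_negf)
  also have "\<dots> = s / a * a * (s / a) - s / a * s - s * (s / a) + Q"
    by (simp add: sum.distrib sum_distrib_left sum_distrib_right sum_negf sum_subtractf
        s_def Q_def algebra_simps flip: sum_divide_distrib)
  also have "\<dots> = Q - s * s / a"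
    using a by (simp add: a_def field_simps)
  also have "s * s / a = (\<Sum>i<n. \<Sum>j<n. f i * (b i * b j / a) * f j)"
    by (simp add: s_def sum_product sum_divide_distrib mult_ac)
  also have "Q - \<dots> = (\<Sum>i<n. \<Sum>j<n. f i * schur_complement A $$ (i, j) * f j)"
    unfolding Q_def sum_subtractf[symmetric] using A
    by (intro sum.cong refl) (simp add: schur_complement_def b' a_def algebra_simps b_def)
  finally show "0 \<le> (\<Sum>i<dim_row (schur_complement A). \<Sum>j<dim_row (schur_complement A).
      f i * schur_complement A $$ (i, j) * f j)"
    using A by (simp add: schur_complement_def)
qed

text \<open>If the first diagonal entry vanishes, the form is affine along the first coordinate and can stay
nonnegative only if the linear term vanishes too.\<close>

lemma psd_zero_diag:
  assumes sym: "\<And>i j. i < dim_row A \<Longrightarrow> j < dim_row A \<Longrightarrow> A $$ (i, j) = A $$ (j, i)"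
    and psd: "psd A" and z: "A $$ (0, 0) = 0" and i: "i < dim_row A"
  shows "A $$ (i, 0) = 0"
proof (rule ccontr)
  let ?n = "dim_row A"
  assume nz: "A $$ (i, 0) \<noteq> 0"
  have i0: "i \<noteq> 0"
  proof
    assume "i = 0"
    with nz z show False by simp
  qed
  \<comment> \<open>The form at \<open>e\<^sub>i + t e\<^sub>0\<close> is \<open>A\<^sub>i\<^sub>i + 2 t A\<^sub>i\<^sub>0\<close>; this \<open>t\<close> makes it \<open>-1\<close>.\<close>
  define t where "t = - (A $$ (i, i) + 1) / (2 * A $$ (i, 0))"
  define u where "u j = of_bool (j = i) + t * of_bool (j = 0)" for j :: nat
  have u: "(\<Sum>j<?n. f j * u j) = f i + t * f 0" for f
  proof -
    have "(\<Sum>j<?n. f j * u j) = (\<Sum>j<?n. f j * of_bool (j = i)) + t * (\<Sum>j<?n. f j * of_bool (j = 0))"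
      unfolding u_def sum_distrib_left sum.distrib[symmetric]
      by (intro sum.cong refl) (simp only: distrib_left mult.left_commute)
    also have "\<dots> = f i + t * f 0"
      using i by (subst (1 2) sum_mult_of_bool) auto
    finally show ?thesis .
  qed
  have "0 \<le> (\<Sum>k<?n. \<Sum>j<?n. u k * A $$ (k, j) * u j)"
    using psd unfolding psd_def by (rule spec)
  also have "\<dots> = (\<Sum>k<?n. (A $$ (k, i) + t * A $$ (k, 0)) * u k)"
    unfolding u[of "\<lambda>j. u k * A $$ (k, j)" for k] by (intro sum.cong refl) (simp add: algebra_simps)
  also have "\<dots> = A $$ (i, i) + t * A $$ (i, 0) + t * (A $$ (0, i) + t * A $$ (0, 0))"
    by (rule u[of "\<lambda>k. A $$ (k, i) + t * A $$ (k, 0)"])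
  also have "\<dots> = A $$ (i, i) + 2 * t * A $$ (i, 0)"
    using z sym[of 0 i] i i0 by simp
  also have "\<dots> = -1"
    using nz by (simp add: t_def field_simps)
  finally show False by simp
qed

text \<open>By induction along Schur complements: eliminating the first row splits off the pivot as a factor of the
determinant and can only decrease the remaining diagonal entries. A zero pivot makes the whole first
column vanish, and with it the determinant.\<close>

lemma hadamard_inequality:
  assumes "A \<in> carrier_mat n n" "\<And>i j. i < n \<Longrightarrow> j < n \<Longrightarrow> A $$ (i, j) = A $$ (j, i)" "psd A"
  shows "0 \<le> Determinant.det A \<and> Determinant.det A \<le> (\<Prod>i<n. A $$ (i, i))"
  using assms
proof (induction n arbitrary: A)
  case 0
  then show ?case by (simp add: det_dim_zero)
next
  case (Suc n)
  let ?S = "schur_complement A"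
  have dim: "dim_row A = Suc n" using Suc.prems by auto
  have diag: "0 \<le> A $$ (i, i)" if "i < Suc n" for i
    using psd_diag[OF Suc.prems(3)] that dim by auto
  show ?case
  proof (cases "A $$ (0, 0) = 0")
    case True
    have "Determinant.det A = 0"
      using True psd_zero_diag[of A] Suc.prems dim
      by (subst laplace_expansion_column[of A "Suc n" 0]) auto
    moreover have "0 \<le> (\<Prod>i<Suc n. A $$ (i, i))"
      using diag by (intro prod_nonneg) auto
    ultimately show ?thesis by simp
  next
    case False
    then have a: "0 < A $$ (0, 0)" using diag[of 0] by simp
    have S: "?S \<in> carrier_mat n n" using Suc.prems(1) by (simp add: schur_complement_def)
    have IH: "0 \<le> Determinant.det ?S \<and> Determinant.det ?S \<le> (\<Prod>i<n. ?S $$ (i, i))"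
    proof (rule Suc.IH[OF S])
      show "?S $$ (i, j) = ?S $$ (j, i)" if "i < n" "j < n" for i j
        using that dim Suc.prems(2)[of "Suc i" "Suc j"] Suc.prems(2)[of "Suc i" 0]
          Suc.prems(2)[of 0 "Suc j"] by (simp add: schur_complement_def)
      show "psd ?S"
        using psd_schur_complement[OF Suc.prems(1) _ Suc.prems(3) a] Suc.prems(2) by auto
    qed
    have "?S $$ (i, i) \<le> A $$ (Suc i, Suc i)" if "i < n" for i
      using that dim a Suc.prems(2)[of 0 "Suc i"] by (simp add: schur_complement_def)
    moreover have "0 \<le> ?S $$ (i, i)" if "i < n" for i
      using psd_diag[OF psd_schur_complement[OF Suc.prems(1) _ Suc.prems(3) a]] that Suc.prems(2) S
      by auto
    ultimately have "(\<Prod>i<n. ?S $$ (i, i)) \<le> (\<Prod>i<n. A $$ (Suc i, Suc i))"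
      by (intro prod_mono) auto
    then have "Determinant.det A \<le> A $$ (0, 0) * (\<Prod>i<n. A $$ (Suc i, Suc i))"
      using det_schur_complement[OF Suc.prems(1) False] IH a by (simp add: mult_left_mono)
    then show ?thesis
      unfolding prod.lessThan_Suc_shift
      using det_schur_complement[OF Suc.prems(1) False] IH a by simp
  qed
qed

text \<open>Concavity of \<open>log det\<close> at the identity matrix, in the form of a tangent inequality: it follows from
Hadamard's inequality and \<open>ln x \<le> x - 1\<close> applied to the diagonal entries.\<close>

lemma ln_det_le_trace:
  assumes A: "A \<in> carrier_mat n n" and sym: "\<And>i j. i < n \<Longrightarrow> j < n \<Longrightarrow> A $$ (i, j) = A $$ (j, i)"
    and psd: "psd A" and det: "Determinant.det A \<noteq> 0"
  shows "0 < Determinant.det A" "ln (Determinant.det A) \<le> (\<Sum>i<n. A $$ (i, i) - 1)"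
proof -
  have H: "0 \<le> Determinant.det A" "Determinant.det A \<le> (\<Prod>i<n. A $$ (i, i))"
    using hadamard_inequality[OF A sym psd] by auto
  show pos: "0 < Determinant.det A" using H det by simp
  then have "(\<Prod>i<n. A $$ (i, i)) \<noteq> 0" using H by linarith
  then have nz: "A $$ (i, i) > 0" if "i < n" for i
    using that psd_diag[OF psd, of i] A by (force simp: less_le)
  have "ln (Determinant.det A) \<le> ln (\<Prod>i<n. A $$ (i, i))"
    using pos H by simp
  also have "\<dots> = (\<Sum>i<n. ln (A $$ (i, i)))"
    using nz by (intro ln_prod) (auto dest: less_imp_neq[OF nz])
  also have "\<dots> \<le> (\<Sum>i<n. A $$ (i, i) - 1)"
    using nz by (intro sum_mono ln_le_minus_one) auto
  finally show "ln (Determinant.det A) \<le> (\<Sum>i<n. A $$ (i, i) - 1)" .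
qed


section \<open>Chebyshev polynomials and their values at the nodes\<close>

text \<open>Both kinds satisfy the same recurrence; the parameter \<open>s\<close> is the leading coefficient in degree one, so
\<open>s = 1\<close> gives the first kind \<open>T\<^sub>n\<close> and \<open>s = 2\<close> the second kind \<open>U\<^sub>n\<close>.\<close>

fun chebyshev_poly :: "real \<Rightarrow> nat \<Rightarrow> real poly" where
  "chebyshev_poly s 0 = 1"
| "chebyshev_poly s (Suc 0) = [:0, s:]"
| "chebyshev_poly s (Suc (Suc n)) = [:0, 2:] * chebyshev_poly s (Suc n) - chebyshev_poly s n"

lemma degree_chebyshev_poly: "degree (chebyshev_poly s n) \<le> n"
proof (induction s n rule: chebyshev_poly.induct)
  case (3 s n)
  have "degree ([:0, 2:] * chebyshev_poly s (Suc n)) \<le> Suc (Suc n)"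
    using degree_mult_le[of "[:0, 2:]" "chebyshev_poly s (Suc n)"] 3 by simp
  then show ?case
    using 3 by (simp only: chebyshev_poly.simps) (intro degree_diff_le, auto)
qed auto

lemma chebyshev_first_kind: "poly (chebyshev_poly 1 n) (cos t) = cos (real n * t)"
proof (induction "1 :: real" n rule: chebyshev_poly.induct)
  case (3 n)
  have "cos (real (Suc (Suc n)) * t) = cos (real (Suc n) * t + t)"
    "cos (real n * t) = cos (real (Suc n) * t - t)"
    by (simp_all add: algebra_simps)
  then show ?case using 3 by (simp add: cos_add cos_diff)
qed auto

lemma chebyshev_second_kind:
  "sin t * poly (chebyshev_poly 2 n) (cos t) = sin (real (Suc n) * t)"
proof (induction "2 :: real" n rule: chebyshev_poly.induct)
  case 2
  then show ?case by (simp add: sin_double)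
next
  case (3 n)
  have "sin (real (Suc (Suc (Suc n))) * t) = sin (real (Suc (Suc n)) * t + t)"
    "sin (real (Suc n) * t) = sin (real (Suc (Suc n)) * t - t)"
    by (simp_all add: algebra_simps)
  moreover have "sin t * poly (chebyshev_poly 2 (Suc (Suc n))) (cos t) =
      2 * cos t * (sin t * poly (chebyshev_poly 2 (Suc n)) (cos t)) -
      sin t * poly (chebyshev_poly 2 n) (cos t)"
    by (simp add: algebra_simps)
  ultimately show ?case using 3 by (simp add: sin_add sin_diff del: of_nat_Suc chebyshev_poly.simps)
qed auto

text \<open>The orthonormal polynomials of the arcsine distribution (\<open>e = 0\<close>, first kind) and of \<open>1 - x\<^sup>2\<close> times the
arcsine distribution (\<open>e = 1\<close>, second kind).\<close>

definition orthopoly :: "nat \<Rightarrow> nat \<Rightarrow> real poly" where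
  "orthopoly e a = (if e = 0 \<and> a = 0 then 1
     else Polynomial.smult (sqrt 2) (chebyshev_poly (if e = 0 then 1 else 2) a))"

text \<open>For \<open>e \<in> {0, 1}\<close>, this is \<open>(sin t)\<^sup>e\<close> times the value of \<open>orthopoly e a\<close> at \<open>cos t\<close>. Its
square is the contribution of one variable to the sums of squares considered below, and the two kinds complement each other:
\<open>2 cos\<^sup>2 (b t) + 2 sin\<^sup>2 (b t) = 2\<close>.\<close>

definition trig :: "nat \<Rightarrow> nat \<Rightarrow> real \<Rightarrow> real" where
  "trig e a t = (if e = 0 then (if a = 0 then 1 else sqrt 2 * cos (real a * t))
     else sqrt 2 * sin (real (Suc a) * t))"

lemma degree_orthopoly: "degree (orthopoly e a) \<le> a"
  using degree_chebyshev_poly by (simp add: orthopoly_def)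

lemma weighted_orthopoly_cos:
  assumes "e \<in> {0, 1}"
  shows "poly (orthopoly e a) (cos t) * poly (orthopoly e b) (cos t) * (1 - (cos t)\<^sup>2) ^ e =
    trig e a t * trig e b t"
proof (cases "e = 0")
  case True
  then show ?thesis by (simp add: orthopoly_def trig_def chebyshev_first_kind)
next
  case False
  then have e: "e = 1" using assms by auto
  have "poly (orthopoly e a) (cos t) * poly (orthopoly e b) (cos t) * (1 - (cos t)\<^sup>2) ^ e =
      (sqrt 2 * (sin t * poly (chebyshev_poly 2 a) (cos t))) *
      (sqrt 2 * (sin t * poly (chebyshev_poly 2 b) (cos t)))"
    using e by (simp add: orthopoly_def flip: sin_squared_eq) (simp add: power2_eq_square)
  then show ?thesis
    unfolding chebyshev_second_kind using e by (simp add: trig_def)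
qed

definition chebyshev_angle :: "nat \<Rightarrow> nat \<Rightarrow> real" where
  "chebyshev_angle n i = (2 * real i - 1) / (2 * (real n + 1)) * pi"

lemma chebyshev_node_cos: "chebyshev_node n i = cos (chebyshev_angle n i)"
  by (simp add: chebyshev_node_def chebyshev_angle_def)

text \<open>The sum telescopes after multiplication by \<open>2 sin h\<close>, where \<open>h\<close> is half the step between consecutive
angles \<open>m \<theta>\<^sub>i\<close>; the angles are the midpoints of their cells, which makes the telescoped sum end in
\<open>sin (m \<pi>) = 0\<close>. The bound on \<open>m\<close> keeps \<open>h\<close> strictly between \<open>0\<close> and \<open>\<pi>\<close>.\<close>

lemma sum_cos_angles:
  assumes m: "0 < m" "m < 2 * (n + 1)"
  shows "(\<Sum>i=1..n+1. cos (real m * chebyshev_angle n i)) = 0"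
proof -
  define h where "h = real m * pi / (2 * (real n + 1))"
  have tel: "2 * sin h * (\<Sum>i=1..k. cos (real m * chebyshev_angle n i)) = sin (2 * real k * h)" for k
  proof (induction k)
    case (Suc k)
    have "real m * chebyshev_angle n (Suc k) = (2 * real k + 1) * h"
      by (simp add: chebyshev_angle_def h_def)
    moreover have "2 * sin h * cos ((2 * real k + 1) * h) =
        sin ((2 * real k + 1) * h + h) - sin ((2 * real k + 1) * h - h)"
      by (simp add: sin_add sin_diff)
    moreover have "(2 * real k + 1) * h + h = 2 * real (Suc k) * h"
      "(2 * real k + 1) * h - h = 2 * real k * h"
      by (simp_all add: algebra_simps)
    moreover have "(\<Sum>i=1..Suc k. cos (real m * chebyshev_angle n i)) =
        (\<Sum>i=1..k. cos (real m * chebyshev_angle n i)) + cos (real m * chebyshev_angle n (Suc k))"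
      by simp
    ultimately show ?case
      using Suc by (simp only: distrib_left)
  qed simp
  have "2 * real (n + 1) * h = real m * pi"
    by (simp add: h_def field_simps)
  then have "2 * sin h * (\<Sum>i=1..n+1. cos (real m * chebyshev_angle n i)) = 0"
    using tel[of "n + 1"] by simp
  moreover have "0 < h" "h < pi"
  proof -
    have "real m < 2 * (real n + 1)" using m(2) of_nat_less_iff[of m "2 * (n + 1)", where 'a = real] by simp
    then have "real m * pi < 2 * (real n + 1) * pi" by simp
    then show "h < pi" by (simp add: h_def divide_less_eq mult.commute)
    show "0 < h" using m by (simp add: h_def)
  qed
  then have "sin h \<noteq> 0"
    using sin_gt_zero[of h] by simp
  ultimately show ?thesis by simp
qed

text \<open>Discrete orthonormality: product-to-sum formulas reduce it to the cosine sums. The restriction on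
the indices keeps all frequencies below \<open>2 (n + 1)\<close>, where aliasing begins.\<close>

lemma sum_trig:
  assumes "e \<in> {0, 1}" "a + e \<le> n" "b + e \<le> n"
  shows "(\<Sum>i=1..n+1. trig e a (chebyshev_angle n i) * trig e b (chebyshev_angle n i)) =
    (if a = b then real n + 1 else 0)"
proof -
  define C where "C m = (\<Sum>i=1..n+1. cos (real m * chebyshev_angle n i))" for m
  have C0: "C 0 = real n + 1" by (simp add: C_def)
  have C: "C m = 0" if "0 < m" "m < 2 * (n + 1)" for m
    unfolding C_def by (rule sum_cos_angles[OF that])
  have main: "(\<Sum>i=1..n+1. 2 * (cos (real a * chebyshev_angle n i) * cos (real b * chebyshev_angle n i)))
      = C (a + b) + C (if a \<le> b then b - a else a - b)"
    "(\<Sum>i=1..n+1. 2 * (sin (real a * chebyshev_angle n i) * sin (real b * chebyshev_angle n i)))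
      = C (if a \<le> b then b - a else a - b) - C (a + b)" for a b
  proof -
    have d: "cos (real (if a \<le> b then b - a else a - b) * t) = cos (real a * t - real b * t)" for t
    proof (cases "a \<le> b")
      case True
      then have "real (b - a) * t = - (real a * t - real b * t)"
        by (simp add: algebra_simps)
      then show ?thesis using True by (simp only: if_True cos_minus)
    next
      case False
      then show ?thesis by (simp add: algebra_simps)
    qed
    have s: "cos (real (a + b) * t) = cos (real a * t + real b * t)" for t
      by (simp add: algebra_simps)
    show "(\<Sum>i=1..n+1. 2 * (cos (real a * chebyshev_angle n i) * cos (real b * chebyshev_angle n i)))
      = C (a + b) + C (if a \<le> b then b - a else a - b)"
      "(\<Sum>i=1..n+1. 2 * (sin (real a * chebyshev_angle n i) * sin (real b * chebyshev_angle n i)))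
      = C (if a \<le> b then b - a else a - b) - C (a + b)"
      unfolding C_def d s sum.distrib[symmetric] sum_subtractf[symmetric]
      by (intro sum.cong refl; simp only: cos_add cos_diff; simp)+
  qed
  have sq: "sqrt 2 * x * (sqrt 2 * y) = 2 * (x * y)" for x y :: real
    by simp
  consider "e = 0" "a = 0" "b = 0" | "e = 0" "a = 0" "b > 0" | "e = 0" "a > 0" "b = 0"
    | "e = 0" "a > 0" "b > 0" | "e = 1"
    using assms(1) by auto
  then show ?thesis
  proof cases
    case 1
    then show ?thesis by (simp add: trig_def)
  next
    case 2
    then show ?thesis using C[of b] assms
      by (simp add: trig_def C_def del: sum.cl_ivl_Suc flip: sum_distrib_left)
  next
    case 3
    then show ?thesis using C[of a] assms
      by (simp add: trig_def C_def del: sum.cl_ivl_Suc flip: sum_distrib_left)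
  next
    case 4
    then have "(\<Sum>i=1..n+1. trig e a (chebyshev_angle n i) * trig e b (chebyshev_angle n i)) =
       C (a + b) + C (if a \<le> b then b - a else a - b)"
      unfolding main(1)[symmetric] by (intro sum.cong refl) (simp add: trig_def)
    then show ?thesis using 4 assms C C0 by auto
  next
    case 5
    then have "(\<Sum>i=1..n+1. trig e a (chebyshev_angle n i) * trig e b (chebyshev_angle n i)) =
       C (if Suc a \<le> Suc b then Suc b - Suc a else Suc a - Suc b) - C (Suc a + Suc b)"
      unfolding main(2)[symmetric] by (intro sum.cong refl) (simp add: trig_def)
    then show ?thesis using 5 assms C C0 by auto
  qed
qed


section \<open>Evaluation of multivariate polynomials and the weights of the cube\<close>

lemma mpoly_eval_superset:
  assumes "finite A" "Poly_Mapping.keys p \<subseteq> A"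
  shows "mpoly_eval p x = (\<Sum>\<alpha>\<in>A. Poly_Mapping.lookup p \<alpha> * monomial_at \<alpha> x)"
  unfolding mpoly_eval_def using assms
  by (intro sum.mono_neutral_left) (auto simp: in_keys_iff)

lemma mpoly_eval_single: "mpoly_eval (Poly_Mapping.single \<alpha> c) x = c * monomial_at \<alpha> x"
  by (subst mpoly_eval_superset[of "{\<alpha>}"]) auto

lemma mpoly_eval_zero: "mpoly_eval 0 x = 0"
  by (simp add: mpoly_eval_def)

lemma mpoly_eval_add: "mpoly_eval (p + q) x = mpoly_eval p x + mpoly_eval q x"
proof -
  let ?A = "Poly_Mapping.keys p \<union> Poly_Mapping.keys q"
  have "mpoly_eval r x = (\<Sum>\<alpha>\<in>?A. Poly_Mapping.lookup r \<alpha> * monomial_at \<alpha> x)"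
    if "Poly_Mapping.keys r \<subseteq> ?A" for r
    using that by (intro mpoly_eval_superset) auto
  then show ?thesis
    using Poly_Mapping.keys_add[of p q]
    by (simp add: lookup_add distrib_right sum.distrib)
qed

lemma mpoly_eval_sum: "mpoly_eval (sum p A) x = (\<Sum>i\<in>A. mpoly_eval (p i) x)"
  by (induction A rule: infinite_finite_induct) (simp_all add: mpoly_eval_zero mpoly_eval_add)

lemma monomial_at_zero [simp]: "monomial_at 0 x = 1"
  by (simp add: monomial_at_def)

lemma monomial_at_add: "monomial_at (\<alpha> + \<beta>) x = monomial_at \<alpha> x * monomial_at \<beta> x"
  by (simp add: monomial_at_def lookup_add power_add prod.distrib)

lemma mpoly_eval_const: "mpoly_eval (Poly_Mapping.single 0 c) x = c"
  by (simp add: mpoly_eval_single)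

lemma mpoly_eval_one: "mpoly_eval 1 x = 1"
  using mpoly_eval_const[of 1 x] by (simp add: single_one)

lemma sum_singles:
  "(\<Sum>\<alpha>\<in>Poly_Mapping.keys p. Poly_Mapping.single \<alpha> (Poly_Mapping.lookup p \<alpha>)) = p"
  by (rule poly_mapping_eqI) (simp add: lookup_sum lookup_single when_def in_keys_iff)

lemma mpoly_eval_mult: "mpoly_eval (p * q) x = mpoly_eval p x * mpoly_eval q x"
proof -
  let ?s = "\<lambda>p \<alpha>. Poly_Mapping.single \<alpha> (Poly_Mapping.lookup p \<alpha>)"
  have "p * q = (\<Sum>\<alpha>\<in>Poly_Mapping.keys p. ?s p \<alpha>) * (\<Sum>\<beta>\<in>Poly_Mapping.keys q. ?s q \<beta>)"
    by (simp only: sum_singles)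
  also have "\<dots> = (\<Sum>\<alpha>\<in>Poly_Mapping.keys p. \<Sum>\<beta>\<in>Poly_Mapping.keys q. ?s p \<alpha> * ?s q \<beta>)"
    by (rule sum_product)
  finally have "mpoly_eval (p * q) x = mpoly_eval \<dots> x" by simp
  also have "\<dots> = mpoly_eval p x * mpoly_eval q x"
    by (simp add: mpoly_eval_sum mult_single mpoly_eval_single monomial_at_add
        mpoly_eval_def[of p] mpoly_eval_def[of q] sum_product mult_ac)
  finally show ?thesis .
qed

lemma mpoly_eval_power: "mpoly_eval (p ^ k) x = mpoly_eval p x ^ k"
  by (induction k) (simp_all add: mpoly_eval_one mpoly_eval_mult)

lemma mpoly_eval_prod: "mpoly_eval (prod p A) x = (\<Prod>i\<in>A. mpoly_eval (p i) x)"
  by (induction A rule: infinite_finite_induct) (simp_all add: mpoly_eval_one mpoly_eval_mult)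

lemma mpoly_eval_uminus: "mpoly_eval (- p) x = - mpoly_eval p x"
  using mpoly_eval_add[of p "- p" x] by (simp add: mpoly_eval_zero)

lemma mpoly_eval_diff: "mpoly_eval (p - q) x = mpoly_eval p x - mpoly_eval q x"
  using mpoly_eval_add[of p "- q" x] by (simp add: mpoly_eval_uminus)

lemma mpoly_eval_Var: "mpoly_eval (Var j) x = x $ j"
proof -
  have "monomial_at (Poly_Mapping.single j 1) x = (\<Prod>i\<in>UNIV. if i = j then x $ j else 1)"
    unfolding monomial_at_def by (intro prod.cong) (auto simp: lookup_single when_def)
  then show ?thesis by (simp add: Var_def mpoly_eval_single)
qed

definition box_poly :: "('d::finite \<Rightarrow> nat) \<Rightarrow> 'd mpoly" where
  "box_poly \<epsilon> = (\<Prod>j\<in>UNIV. (1 - Var j ^ 2) ^ \<epsilon> j)"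

definition box_exponents :: "nat \<Rightarrow> ('d::finite \<Rightarrow> nat) set" where
  "box_exponents n = {\<epsilon>. (\<forall>j. \<epsilon> j \<in> {0, 1}) \<and> (\<Sum>j\<in>UNIV. \<epsilon> j) \<le> n}"

lemma G_box_eq: "G_box n = box_poly ` box_exponents n"
  unfolding G_box_def box_poly_def box_exponents_def ..

lemma finite_box_exponents: "finite (box_exponents n :: ('d::finite \<Rightarrow> nat) set)"
proof (rule finite_subset)
  show "(box_exponents n :: ('d \<Rightarrow> nat) set) \<subseteq> Pi\<^sub>E UNIV (\<lambda>_. {0, 1})"
    unfolding box_exponents_def PiE_UNIV_domain by blast
qed (simp add: finite_PiE)

lemma mpoly_eval_box_poly: "mpoly_eval (box_poly \<epsilon>) x = (\<Prod>j\<in>UNIV. (1 - (x $ j)\<^sup>2) ^ \<epsilon> j)"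
  by (simp add: box_poly_def mpoly_eval_prod mpoly_eval_power mpoly_eval_diff mpoly_eval_one
      mpoly_eval_Var)

text \<open>Evaluation at the unit vector of the variable \<open>j\<close> tells whether the factor \<open>1 - x\<^sub>j\<^sup>2\<close> is present. Sums over
polynomials in \<open>G_box n\<close> therefore are sums over exponent vectors.\<close>

lemma inj_on_box_poly: "inj_on box_poly (box_exponents n)"
proof (rule inj_onI)
  fix \<epsilon> \<delta> :: "'d::finite \<Rightarrow> nat"
  assume \<epsilon>: "\<epsilon> \<in> box_exponents n" and \<delta>: "\<delta> \<in> box_exponents n" and eq: "box_poly \<epsilon> = box_poly \<delta>"
  have eval: "mpoly_eval (box_poly \<gamma>) (axis j 1) = 0 \<longleftrightarrow> \<gamma> j \<noteq> 0" for \<gamma> and j :: 'd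
  proof -
    have "(1 - (axis j 1 $ i :: real)\<^sup>2) ^ \<gamma> i = (if i = j then 0 ^ \<gamma> j else 1)" for i
      by (simp add: axis_def)
    then show ?thesis by (simp add: mpoly_eval_box_poly)
  qed
  show "\<epsilon> = \<delta>"
  proof
    fix j
    have "\<epsilon> j \<noteq> 0 \<longleftrightarrow> \<delta> j \<noteq> 0"
      using eval[of \<epsilon> j] eval[of \<delta> j] eq by simp
    moreover have "\<epsilon> j \<in> {0, 1}" "\<delta> j \<in> {0, 1}"
      using \<epsilon> \<delta> by (auto simp: box_exponents_def)
    ultimately show "\<epsilon> j = \<delta> j" by auto
  qed
qed

lemma prod_single:
  "finite A \<Longrightarrow> (\<Prod>j\<in>A. Poly_Mapping.single (m j) (c j :: real)) =
    Poly_Mapping.single (\<Sum>j\<in>A. m j) (\<Prod>j\<in>A. c j)"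
  by (induction A rule: finite_induct) (simp_all add: mult_single)

lemma lookup_sum_single:
  "finite A \<Longrightarrow> Poly_Mapping.lookup (\<Sum>j\<in>A. Poly_Mapping.single j (c :: nat)) i =
    (if i \<in> A then c else 0)"
  by (induction A rule: finite_induct) (auto simp: lookup_add lookup_single when_def)

text \<open>Expanding the product gives one monomial with coefficient \<open>\<plusminus>1\<close> for each subset \<open>F\<close> of the set of factors,
namely \<open>\<Prod>j\<in>F. x\<^sub>j\<^sup>2\<close>; different subsets give different monomials, so nothing cancels and the full set
determines the degree.\<close>

lemma total_degree_box_poly:
  fixes \<epsilon> :: "'d::finite \<Rightarrow> nat"
  assumes "\<forall>j. \<epsilon> j \<in> {0, 1}"
  shows "total_degree (box_poly \<epsilon>) = 2 * (\<Sum>j\<in>UNIV. \<epsilon> j)"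
proof -
  define E where "E = {j. \<epsilon> j = 1}"
  define m :: "'d set \<Rightarrow> 'd multi_index" where "m F = (\<Sum>j\<in>F. Poly_Mapping.single j 2)" for F
  have off_E: "\<epsilon> j = 0" if "j \<notin> E" for j
    using assms that by (auto simp: E_def)
  have on_E: "\<epsilon> j = 1" if "j \<in> E" for j
    using that by (simp add: E_def)
  have sum\<epsilon>: "(\<Sum>j\<in>UNIV. \<epsilon> j) = card E"
  proof -
    have "(\<Sum>j\<in>UNIV. \<epsilon> j) = (\<Sum>j\<in>E. 1)"
      using assms by (intro sum.mono_neutral_cong_right) (auto simp: off_E on_E)
    then show ?thesis by simp
  qed
  have lookup_m: "Poly_Mapping.lookup (m F) i = (if i \<in> F then 2 else 0)" for F i
    unfolding m_def by (rule lookup_sum_single) simp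
  have deg_m: "mi_degree (m F) = 2 * card F" for F
    by (simp add: mi_degree_def lookup_m sum.If_cases)
  have inj_m: "m F = m F' \<longleftrightarrow> F = F'" for F F'
  proof
    assume "m F = m F'"
    then have "i \<in> F \<longleftrightarrow> i \<in> F'" for i
      using lookup_m[of F i] lookup_m[of F' i] by (auto split: if_splits)
    then show "F = F'" by auto
  qed simp
  have "box_poly \<epsilon> = (\<Prod>j\<in>E. - (Var j ^ 2) + 1)"
    unfolding box_poly_def
    by (intro prod.mono_neutral_cong_right) (auto simp: off_E on_E)
  also have "\<dots> = (\<Sum>F\<in>Pow E. (\<Prod>j\<in>F. - (Var j ^ 2)) * (\<Prod>j\<in>E - F. 1))"
    by (rule prod_add) simp
  also have "\<dots> = (\<Sum>F\<in>Pow E. Poly_Mapping.single (m F) ((-1) ^ card F))"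
  proof (intro sum.cong refl)
    fix F :: "'d set"
    have "(\<Prod>j\<in>F. - ((Var j :: 'd mpoly) ^ 2)) = (\<Prod>j\<in>F. Poly_Mapping.single (Poly_Mapping.single j 2) (- 1 :: real))"
      by (intro prod.cong refl)
        (simp add: Var_def numeral_2_eq_2 mult_single single_uminus flip: single_add)
    then show "(\<Prod>j\<in>F. - (Var j ^ 2)) * (\<Prod>j\<in>E - F. 1) = Poly_Mapping.single (m F) ((-1) ^ card F)"
      by (simp add: prod_single m_def)
  qed
  finally have box: "box_poly \<epsilon> = \<dots>" .
  have lookup: "Poly_Mapping.lookup (box_poly \<epsilon>) \<alpha> =
      (\<Sum>F\<in>Pow E. if m F = \<alpha> then (-1) ^ card F else 0)" for \<alpha>
    unfolding box by (simp add: lookup_sum lookup_single when_def)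
  have keys: "Poly_Mapping.keys (box_poly \<epsilon>) \<subseteq> m ` Pow E"
    unfolding box using keys_sum[of "\<lambda>F. Poly_Mapping.single (m F) ((-1) ^ card F :: real)" "Pow E"]
    by (auto split: if_splits)
  have "Poly_Mapping.lookup (box_poly \<epsilon>) (m E) = (-1) ^ card E"
    unfolding lookup by (simp add: inj_m sum.delta)
  then have mE: "m E \<in> Poly_Mapping.keys (box_poly \<epsilon>)"
    by (simp add: in_keys_iff)
  have keys_deg: "mi_degree \<alpha> \<le> 2 * card E" if \<alpha>: "\<alpha> \<in> Poly_Mapping.keys (box_poly \<epsilon>)" for \<alpha>
  proof -
    obtain F where "\<alpha> = m F" "F \<subseteq> E" using keys \<alpha> by blast
    then show ?thesis by (simp add: deg_m card_mono)
  qed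
  show ?thesis
    unfolding total_degree_def sum\<epsilon>
  proof (rule Max_eqI)
    fix k assume "k \<in> insert 0 (mi_degree ` Poly_Mapping.keys (box_poly \<epsilon>))"
    then show "k \<le> 2 * card E"
      using keys_deg by auto
  qed (use mE deg_m[of E] in \<open>auto intro!: image_eqI[of _ _ "m E"]\<close>)
qed

lemma half_degree_box_poly:
  assumes "\<forall>j. \<epsilon> j \<in> {0, 1}"
  shows "half_degree (box_poly \<epsilon>) = (\<Sum>j\<in>UNIV. \<epsilon> j)"
  by (simp add: half_degree_def total_degree_box_poly[OF assms] del: of_nat_sum)

text \<open>The inductively defined polynomial functions, in terms of which the Stone-Weierstrass theorem is stated,
are the evaluations of elements of the monoid algebra.\<close>

lemma real_polynomial_function_mpoly:
  fixes f :: "real^'d::finite \<Rightarrow> real"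
  assumes "real_polynomial_function f"
  shows "\<exists>p. f = mpoly_eval p"
  using assms
proof (induction rule: real_polynomial_function.induct)
  case (linear f)
  have "f x = mpoly_eval (\<Sum>j\<in>UNIV. Poly_Mapping.single 0 (f (axis j 1)) * Var j) x" for x
  proof -
    have "f x = f (\<Sum>j\<in>UNIV. x $ j *\<^sub>R axis j 1)"
      by (simp add: basis_expansion flip: scalar_mult_eq_scaleR)
    also have "\<dots> = (\<Sum>j\<in>UNIV. x $ j * f (axis j 1))"
      using linear by (simp add: bounded_linear.linear linear_sum linear_scale)
    finally show ?thesis
      by (simp add: mpoly_eval_sum mpoly_eval_mult mpoly_eval_const mpoly_eval_Var mult_ac)
  qed
  then show ?case by blast
next
  case (const c)
  have "(\<lambda>x. c) = mpoly_eval (Poly_Mapping.single 0 c)" by (simp add: fun_eq_iff mpoly_eval_const)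
  then show ?case by blast
next
  case (add f g)
  then obtain p q where "f = mpoly_eval p" "g = mpoly_eval q" by blast
  then have "(\<lambda>x. f x + g x) = mpoly_eval (p + q)" by (simp add: fun_eq_iff mpoly_eval_add)
  then show ?case by blast
next
  case (mult f g)
  then obtain p q where "f = mpoly_eval p" "g = mpoly_eval q" by blast
  then have "(\<lambda>x. f x * g x) = mpoly_eval (p * q)" by (simp add: fun_eq_iff mpoly_eval_mult)
  then show ?case by blast
qed


section \<open>Integration against measures on the cube\<close>

lemma prob_space_gauss_chebyshev: "prob_space (gauss_chebyshev n)"
  unfolding gauss_chebyshev_def
  by (intro prob_space.prob_space_distr prob_space_uniform_count_measure measurable_chebyshev_node) auto

lemma gauss_chebyshev_integral:
  fixes f :: "real \<Rightarrow> real"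
  assumes "f \<in> borel_measurable borel"
  shows "integrable (gauss_chebyshev n) f"
    "(\<integral>t. f t \<partial>gauss_chebyshev n) = (\<Sum>i=1..n+1. f (chebyshev_node n i)) / (real n + 1)"
proof -
  have f: "f \<in> borel_measurable (restrict_space borel {-1..1})"
    using assms by (rule measurable_restrict_space1)
  show "integrable (gauss_chebyshev n) f"
    unfolding gauss_chebyshev_def
    by (subst integrable_distr_eq[OF measurable_chebyshev_node f])
      (simp add: uniform_count_measure_def integrable_point_measure_finite)
  have "(\<integral>t. f t \<partial>gauss_chebyshev n) = (\<Sum>i=1..n+1. f (chebyshev_node n i)) / real (card {1..n+1})"
    unfolding gauss_chebyshev_def
    by (subst integral_distr[OF measurable_chebyshev_node f], subst integral_uniform_count_measure) auto
  then show "(\<integral>t. f t \<partial>gauss_chebyshev n) = (\<Sum>i=1..n+1. f (chebyshev_node n i)) / (real n + 1)"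
    by (simp add: add.commute)
qed

lemma measurable_vec_lambda_gauss_chebyshev:
  "(\<lambda>x. \<chi> j. x j) \<in> Pi\<^sub>M (UNIV :: 'd::finite set) (\<lambda>_. gauss_chebyshev n) \<rightarrow>\<^sub>M
     restrict_space borel (cube :: (real^'d) set)"
proof -
  let ?P = "Pi\<^sub>M (UNIV :: 'd set) (\<lambda>_. gauss_chebyshev n)"
  have id: "(\<lambda>y. y) \<in> gauss_chebyshev n \<rightarrow>\<^sub>M borel"
    by (simp add: gauss_chebyshev_def measurable_restrict_space1 cong: measurable_cong_sets)
  have comp: "(\<lambda>x. x j) \<in> borel_measurable ?P" for j
    using measurable_compose[OF measurable_component_singleton[of j UNIV] id] by simp
  have "(\<lambda>x. \<chi> j. x j) \<in> borel_measurable ?P"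
    by (subst borel_measurable_euclidean_space)
       (auto simp: Basis_vec_def inner_axis intro!: borel_measurable_inner comp)
  then show ?thesis
    by (intro measurable_restrict_space2)
       (auto simp: cube_def space_PiM gauss_chebyshev_def space_restrict_space PiE_def Pi_def)
qed

text \<open>Integrals of products of univariate functions are all that is ever needed of the atomic product measure:
they turn orthonormality and exactness of quadrature into univariate statements.\<close>

lemma gauss_chebyshev_prod_integral_prod:
  fixes f :: "'d::finite \<Rightarrow> real \<Rightarrow> real"
  assumes f: "\<And>j. f j \<in> borel_measurable borel"
  shows "(\<integral>x. (\<Prod>j\<in>UNIV. f j (x $ j)) \<partial>gauss_chebyshev_prod n) =
    (\<Prod>j\<in>UNIV. (\<Sum>i=1..n+1. f j (chebyshev_node n i)) / (real n + 1))"
proof -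
  interpret product_sigma_finite "\<lambda>_ :: 'd. gauss_chebyshev n"
    using prob_space_gauss_chebyshev by (intro product_sigma_finite.intro prob_space_imp_sigma_finite)
  have [measurable]: "f j \<in> borel_measurable borel" for j by (rule f)
  have "(\<lambda>x :: real^'d. \<Prod>j\<in>UNIV. f j (x $ j)) \<in> borel_measurable borel"
    by measurable
  then have m: "(\<lambda>x :: real^'d. \<Prod>j\<in>UNIV. f j (x $ j)) \<in> borel_measurable (restrict_space borel cube)"
    by (rule measurable_restrict_space1)
  have "(\<integral>x. (\<Prod>j\<in>UNIV. f j (x $ j)) \<partial>gauss_chebyshev_prod n) =
      (\<integral>x. (\<Prod>j\<in>UNIV. f j (x j)) \<partial>Pi\<^sub>M UNIV (\<lambda>_ :: 'd. gauss_chebyshev n))"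
    unfolding gauss_chebyshev_prod_def
    by (subst integral_distr[OF measurable_vec_lambda_gauss_chebyshev m]) simp
  also have "\<dots> = (\<Prod>j\<in>UNIV. \<integral>t. f j t \<partial>gauss_chebyshev n)"
    by (intro product_integral_prod) (auto intro: gauss_chebyshev_integral f)
  finally show ?thesis
    by (simp add: gauss_chebyshev_integral(2)[OF f])
qed

lemma cube_eq_cbox: "cube = cbox (- 1) (1 :: real^'d::finite)"
  by (auto simp: cube_def mem_box_cart)

lemma compact_cube: "compact (cube :: (real^'d::finite) set)"
  unfolding cube_eq_cbox by (rule compact_cbox)

lemma space_borel_prob_measures:
  assumes "\<phi> \<in> borel_prob_measures S"
  shows "space \<phi> = S"
proof -
  have "sets \<phi> = sets (restrict_space borel S)"
    using assms by (simp add: borel_prob_measures_def)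
  from sets_eq_imp_space_eq[OF this] show ?thesis by (simp add: space_restrict_space)
qed

lemma integrable_continuous_on_cube:
  fixes f :: "real^'d::finite \<Rightarrow> real"
  assumes \<phi>: "\<phi> \<in> borel_prob_measures cube" and f: "continuous_on cube f"
  shows "integrable \<phi> f"
proof -
  interpret prob_space \<phi> using \<phi> by (simp add: borel_prob_measures_def)
  have sets: "sets \<phi> = sets (restrict_space borel cube)"
    using \<phi> by (simp add: borel_prob_measures_def)
  have "bounded (f ` cube)"
    using compact_continuous_image[OF f compact_cube] by (rule compact_imp_bounded)
  then obtain B where "\<forall>x\<in>cube. norm (f x) \<le> B"
    by (auto simp: bounded_iff)
  moreover have "f \<in> borel_measurable \<phi>"
    using borel_measurable_continuous_on_restrict[OF f] measurable_cong_sets[OF sets refl] by blast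
  ultimately show ?thesis
    by (intro integrable_const_bound[of _ B]) (auto simp: space_borel_prob_measures[OF \<phi>])
qed

lemma continuous_on_monomial_at [continuous_intros]:
  "continuous_on S (\<lambda>x. monomial_at \<alpha> x)"
  unfolding monomial_at_def by (intro continuous_intros)

lemma continuous_on_mpoly_eval [continuous_intros]:
  "continuous_on S (\<lambda>x. mpoly_eval p x)"
  unfolding mpoly_eval_def by (intro continuous_intros)


section \<open>Optimality of the Gauss-Chebyshev measure\<close>

lemma lookup_Abs_finite: "Poly_Mapping.lookup (Abs_poly_mapping (g :: 'd::finite \<Rightarrow> nat)) = g"
  by (rule Abs_poly_mapping_inverse) simp

lemma finite_mi_degree_le: "finite {\<alpha> :: 'd::finite multi_index. mi_degree \<alpha> \<le> k}"
  using finite_set[of "multi_indices k :: 'd multi_index list"] by (simp only: multi_indices(2))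

lemma lookup_le_mi_degree: "Poly_Mapping.lookup \<alpha> j \<le> mi_degree \<alpha>"
  unfolding mi_degree_def by (rule member_le_sum) auto

lemma sum_multi_indices_nth:
  fixes k :: nat and F :: "'d::finite multi_index \<Rightarrow> 'a::comm_monoid_add"
  shows "(\<Sum>i<length (multi_indices k :: 'd multi_index list). F (multi_indices k ! i)) =
    (\<Sum>\<alpha> | mi_degree \<alpha> \<le> k. F \<alpha>)"
  using sum.reindex_bij_betw[OF bij_betw_nth[OF multi_indices(1) refl multi_indices(2)[symmetric]], of F]
  by simp

text \<open>The product basis adapted to the weight \<open>\<Prod>j. (1 - x\<^sub>j\<^sup>2)\<^sup>\<epsilon>\<^sub>j\<close>.\<close>

definition ortho :: "('d::finite \<Rightarrow> nat) \<Rightarrow> 'd multi_index \<Rightarrow> real^'d \<Rightarrow> real" where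
  "ortho \<epsilon> \<alpha> x = (\<Prod>j\<in>UNIV. poly (orthopoly (\<epsilon> j) (Poly_Mapping.lookup \<alpha> j)) (x $ j))"

definition ortho_coeff :: "('d::finite \<Rightarrow> nat) \<Rightarrow> 'd multi_index \<Rightarrow> 'd multi_index \<Rightarrow> real" where
  "ortho_coeff \<epsilon> \<alpha> \<beta> =
     (\<Prod>j\<in>UNIV. coeff (orthopoly (\<epsilon> j) (Poly_Mapping.lookup \<alpha> j)) (Poly_Mapping.lookup \<beta> j))"

lemma continuous_on_ortho [continuous_intros]: "continuous_on S (\<lambda>x. ortho \<epsilon> \<alpha> x)"
  unfolding ortho_def by (intro continuous_intros)

text \<open>The product expands into monomials whose exponents are bounded by \<open>\<alpha>\<close> in each variable, and these have
total degree at most that of \<open>\<alpha>\<close>. Hence the product basis of degree at most \<open>k\<close> spans no more than the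
monomials of degree at most \<open>k\<close>, although each factor alone is expanded up to degree \<open>k\<close>.\<close>

lemma ortho_expansion:
  fixes \<alpha> :: "'d::finite multi_index"
  assumes \<alpha>: "mi_degree \<alpha> \<le> k"
  shows "ortho \<epsilon> \<alpha> x = (\<Sum>\<beta> | mi_degree \<beta> \<le> k. ortho_coeff \<epsilon> \<alpha> \<beta> * monomial_at \<beta> x)"
proof -
  define p where "p j = orthopoly (\<epsilon> j) (Poly_Mapping.lookup \<alpha> j)" for j
  define h where "h g = (\<Prod>j\<in>UNIV. coeff (p j) (g j) * (x $ j) ^ g j)" for g :: "'d \<Rightarrow> nat"
  have deg: "degree (p j) \<le> Poly_Mapping.lookup \<alpha> j" for j
    unfolding p_def by (rule degree_orthopoly)
  have "poly (p j) t = (\<Sum>i\<le>k. coeff (p j) i * t ^ i)" for j t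
    unfolding poly_altdef using deg[of j] lookup_le_mi_degree[of \<alpha> j] \<alpha>
    by (intro sum.mono_neutral_left) (auto simp: coeff_eq_0)
  then have "ortho \<epsilon> \<alpha> x = (\<Prod>j\<in>UNIV. \<Sum>i\<in>{..k}. coeff (p j) i * (x $ j) ^ i)"
    unfolding ortho_def p_def[symmetric] by simp
  also have "\<dots> = (\<Sum>g\<in>Pi\<^sub>E UNIV (\<lambda>_. {..k}). h g)"
    unfolding h_def by (rule prod_sum_PiE) auto
  also have "\<dots> = (\<Sum>g\<in>Poly_Mapping.lookup ` {\<beta>. mi_degree \<beta> \<le> k}. h g)"
  proof (rule sum.mono_neutral_right)
    show "Poly_Mapping.lookup ` {\<beta> :: 'd multi_index. mi_degree \<beta> \<le> k} \<subseteq> Pi\<^sub>E UNIV (\<lambda>_. {..k})"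
      using order_trans[OF lookup_le_mi_degree] by (auto simp: PiE_UNIV_domain)
    show "\<forall>g\<in>Pi\<^sub>E UNIV (\<lambda>_. {..k}) - Poly_Mapping.lookup ` {\<beta> :: 'd multi_index. mi_degree \<beta> \<le> k}. h g = 0"
    proof
      fix g :: "'d \<Rightarrow> nat"
      assume g: "g \<in> Pi\<^sub>E UNIV (\<lambda>_. {..k}) - Poly_Mapping.lookup ` {\<beta> :: 'd multi_index. mi_degree \<beta> \<le> k}"
      have "\<exists>j. Poly_Mapping.lookup \<alpha> j < g j"
      proof (rule ccontr)
        assume "\<not> ?thesis"
        then have "(\<Sum>j\<in>UNIV. g j) \<le> mi_degree \<alpha>"
          unfolding mi_degree_def by (intro sum_mono) (simp add: not_less)
        then have "mi_degree (Abs_poly_mapping g) \<le> k"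
          using \<alpha> by (simp add: mi_degree_def lookup_Abs_finite)
        then show False
          using g lookup_Abs_finite[of g] by (metis DiffD2 image_eqI mem_Collect_eq)
      qed
      then obtain j where "degree (p j) < g j" using deg le_less_trans by blast
      then show "h g = 0" unfolding h_def by (intro prod_zero bexI[of _ j]) (auto simp: coeff_eq_0)
    qed
  qed (simp add: finite_PiE)
  also have "\<dots> = (\<Sum>\<beta> | mi_degree \<beta> \<le> k. h (Poly_Mapping.lookup \<beta>))"
    by (subst sum.reindex) (auto intro!: inj_onI poly_mapping_eqI)
  also have "\<dots> = (\<Sum>\<beta> | mi_degree \<beta> \<le> k. ortho_coeff \<epsilon> \<alpha> \<beta> * monomial_at \<beta> x)"
    by (simp add: h_def p_def ortho_coeff_def monomial_at_def prod.distrib)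
  finally show ?thesis .
qed

lemma integral_double_sum:
  fixes F :: "'a \<Rightarrow> 'b \<Rightarrow> real^'d::finite \<Rightarrow> real"
  assumes \<phi>: "\<phi> \<in> borel_prob_measures cube"
    and F: "\<And>i j. i \<in> I \<Longrightarrow> j \<in> J i \<Longrightarrow> continuous_on cube (F i j)"
  shows "(\<integral>x. (\<Sum>i\<in>I. \<Sum>j\<in>J i. F i j x) \<partial>\<phi>) = (\<Sum>i\<in>I. \<Sum>j\<in>J i. \<integral>x. F i j x \<partial>\<phi>)"
proof -
  have int: "integrable \<phi> (F i j)" if "i \<in> I" "j \<in> J i" for i j
    using integrable_continuous_on_cube[OF \<phi> F[OF that]] .
  have "(\<integral>x. (\<Sum>i\<in>I. \<Sum>j\<in>J i. F i j x) \<partial>\<phi>) = (\<Sum>i\<in>I. \<integral>x. (\<Sum>j\<in>J i. F i j x) \<partial>\<phi>)"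
    by (intro Bochner_Integration.integral_sum Bochner_Integration.integrable_sum int)
  also have "\<dots> = (\<Sum>i\<in>I. \<Sum>j\<in>J i. \<integral>x. F i j x \<partial>\<phi>)"
    by (intro sum.cong refl Bochner_Integration.integral_sum int)
  finally show ?thesis .
qed

text \<open>The moment matrix with respect to the product basis instead of the monomials.\<close>

definition ortho_gram :: "nat \<Rightarrow> ('d::finite \<Rightarrow> nat) \<Rightarrow> (real^'d) measure \<Rightarrow> real Matrix.mat" where
  "ortho_gram k \<epsilon> \<phi> =
     (let as = multi_indices k; N = length as in
      Matrix.mat N N (\<lambda>(i, j).
        \<integral>x. ortho \<epsilon> (as ! i) x * ortho \<epsilon> (as ! j) x * mpoly_eval (box_poly \<epsilon>) x \<partial>\<phi>))"

definition change_of_basis :: "nat \<Rightarrow> ('d::finite \<Rightarrow> nat) \<Rightarrow> real Matrix.mat" where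
  "change_of_basis k \<epsilon> =
     (let as = multi_indices k; N = length as in
      Matrix.mat N N (\<lambda>(i, j). ortho_coeff \<epsilon> (as ! i) (as ! j)))"

lemma ortho_gram_eq:
  fixes \<epsilon> :: "'d::finite \<Rightarrow> nat"
  assumes \<phi>: "\<phi> \<in> borel_prob_measures cube"
  shows "ortho_gram k \<epsilon> \<phi> = change_of_basis k \<epsilon> * moment_matrix k (box_poly \<epsilon>) \<phi> *
    transpose_mat (change_of_basis k \<epsilon>)"
proof -
  define as :: "'d multi_index list" where "as = multi_indices k"
  define N where "N = length as"
  define T where "T = change_of_basis k \<epsilon>"
  define M where "M = moment_matrix k (box_poly \<epsilon>) \<phi>"
  have T: "T \<in> carrier_mat N N" and M: "M \<in> carrier_mat N N"
    by (simp_all add: T_def M_def change_of_basis_def moment_matrix_def Let_def N_def as_def)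
  have Tij: "T $$ (i, j) = ortho_coeff \<epsilon> (as ! i) (as ! j)" if "i < N" "j < N" for i j
    using that by (simp add: T_def change_of_basis_def Let_def N_def as_def)
  have Mij: "M $$ (i, j) = (\<integral>x. monomial_at (as ! i) x * monomial_at (as ! j) x * mpoly_eval (box_poly \<epsilon>) x \<partial>\<phi>)"
    if "i < N" "j < N" for i j
    using that by (simp add: M_def moment_matrix_def Let_def N_def as_def monomial_vec_def vec_of_list_index)
  have ortho: "ortho \<epsilon> (as ! i) x = (\<Sum>a<N. T $$ (i, a) * monomial_at (as ! a) x)" if "i < N" for i x
  proof -
    have "as ! i \<in> {\<alpha>. mi_degree \<alpha> \<le> k}"
      using nth_mem[of i as] that multi_indices(2)[of k, where 'd = 'd] by (simp only: N_def as_def)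
    then have "ortho \<epsilon> (as ! i) x = (\<Sum>\<beta> | mi_degree \<beta> \<le> k. ortho_coeff \<epsilon> (as ! i) \<beta> * monomial_at \<beta> x)"
      by (intro ortho_expansion) simp
    also have "\<dots> = (\<Sum>a<N. ortho_coeff \<epsilon> (as ! i) (as ! a) * monomial_at (as ! a) x)"
      unfolding N_def as_def by (rule sum_multi_indices_nth[symmetric])
    finally show ?thesis using Tij that by simp
  qed
  have "ortho_gram k \<epsilon> \<phi> = T * M * transpose_mat T"
  proof (rule eq_matI)
    show "dim_row (ortho_gram k \<epsilon> \<phi>) = dim_row (T * M * transpose_mat T)"
      "dim_col (ortho_gram k \<epsilon> \<phi>) = dim_col (T * M * transpose_mat T)"
      using T by (auto simp: ortho_gram_def Let_def N_def as_def)
    fix i j assume "i < dim_row (T * M * transpose_mat T)" "j < dim_col (T * M * transpose_mat T)"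
    then have ij: "i < N" "j < N" using T by auto
    have "ortho_gram k \<epsilon> \<phi> $$ (i, j) =
        (\<integral>x. ortho \<epsilon> (as ! i) x * ortho \<epsilon> (as ! j) x * mpoly_eval (box_poly \<epsilon>) x \<partial>\<phi>)"
      using ij by (simp add: ortho_gram_def Let_def N_def as_def)
    also have "\<dots> = (\<integral>x. (\<Sum>a<N. \<Sum>b<N. T $$ (i, a) * T $$ (j, b) *
        (monomial_at (as ! a) x * monomial_at (as ! b) x * mpoly_eval (box_poly \<epsilon>) x)) \<partial>\<phi>)"
      unfolding ortho[OF ij(1)] ortho[OF ij(2)] sum_product
      by (simp add: sum_distrib_left sum_distrib_right mult_ac)
    also have "\<dots> = (\<Sum>a<N. \<Sum>b<N. T $$ (i, a) * T $$ (j, b) *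
        (\<integral>x. monomial_at (as ! a) x * monomial_at (as ! b) x * mpoly_eval (box_poly \<epsilon>) x \<partial>\<phi>))"
      by (subst integral_double_sum[OF \<phi>]) (auto intro!: continuous_intros)
    also have "\<dots> = (\<Sum>a<N. T $$ (i, a) * (\<Sum>b<N. M $$ (a, b) * T $$ (j, b)))"
      by (simp add: Mij sum_distrib_left sum_distrib_right mult_ac)
    also have "\<dots> = (T * M * transpose_mat T) $$ (i, j)"
      using ij T M by (simp add: scalar_prod_def atLeast0LessThan)
    finally show "ortho_gram k \<epsilon> \<phi> $$ (i, j) = (T * M * transpose_mat T) $$ (i, j)" .
  qed
  then show ?thesis by (simp add: T_def M_def)
qed

text \<open>Passing to the product basis multiplies all determinants by the same constant, whatever the measure.\<close>

lemma det_ortho_gram: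
  fixes \<epsilon> :: "'d::finite \<Rightarrow> nat"
  assumes \<phi>: "\<phi> \<in> borel_prob_measures cube"
  shows "Determinant.det (ortho_gram k \<epsilon> \<phi>) =
    (Determinant.det (change_of_basis k \<epsilon>))\<^sup>2 * Determinant.det (moment_matrix k (box_poly \<epsilon>) \<phi>)"
proof -
  let ?N = "length (multi_indices k :: 'd multi_index list)"
  have "change_of_basis k \<epsilon> \<in> carrier_mat ?N ?N" "moment_matrix k (box_poly \<epsilon>) \<phi> \<in> carrier_mat ?N ?N"
    by (simp_all add: change_of_basis_def moment_matrix_def Let_def)
  then show ?thesis
    unfolding ortho_gram_eq[OF \<phi>]
    by (simp add: det_mult[of _ ?N] det_transpose[of _ ?N] power2_eq_square)
qed

lemma mpoly_eval_box_poly_nonneg: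
  assumes "x \<in> cube"
  shows "0 \<le> mpoly_eval (box_poly \<epsilon>) x"
proof -
  have "0 \<le> 1 - (x $ j)\<^sup>2" for j
    using assms abs_square_le_1[of "x $ j"] by (auto simp: cube_def abs_le_iff)
  then show ?thesis
    unfolding mpoly_eval_box_poly by (intro prod_nonneg) auto
qed

text \<open>The quadratic form of a Gram matrix is the integral of a square times a weight that is nonnegative on
the cube.\<close>

lemma psd_ortho_gram:
  fixes \<epsilon> :: "'d::finite \<Rightarrow> nat"
  assumes \<phi>: "\<phi> \<in> borel_prob_measures cube"
  shows "psd (ortho_gram k \<epsilon> \<phi>)"
  unfolding psd_def
proof
  fix f :: "nat \<Rightarrow> real"
  define as :: "'d multi_index list" where "as = multi_indices k"
  define N where "N = length as"
  define g where "g = mpoly_eval (box_poly \<epsilon>)"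
  have dim: "dim_row (ortho_gram k \<epsilon> \<phi>) = N"
    by (simp add: ortho_gram_def Let_def N_def as_def)
  have cont [continuous_intros]: "continuous_on cube g"
    unfolding g_def by (intro continuous_intros)
  have "0 \<le> (\<integral>x. (\<Sum>i<N. f i * ortho \<epsilon> (as ! i) x)\<^sup>2 * g x \<partial>\<phi>)"
    by (intro integral_nonneg_AE AE_I2)
      (auto simp: space_borel_prob_measures[OF \<phi>] g_def mpoly_eval_box_poly_nonneg)
  also have "\<dots> = (\<integral>x. (\<Sum>i<N. \<Sum>j<N. f i * f j * (ortho \<epsilon> (as ! i) x * ortho \<epsilon> (as ! j) x * g x)) \<partial>\<phi>)"
    unfolding power2_eq_square sum_product
    by (simp add: sum_distrib_left sum_distrib_right mult_ac)
  also have "\<dots> = (\<Sum>i<N. \<Sum>j<N. f i * f j * (\<integral>x. ortho \<epsilon> (as ! i) x * ortho \<epsilon> (as ! j) x * g x \<partial>\<phi>))"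
    by (subst integral_double_sum[OF \<phi>]) (auto intro!: continuous_intros)
  also have "\<dots> = (\<Sum>i<N. \<Sum>j<N. f i * ortho_gram k \<epsilon> \<phi> $$ (i, j) * f j)"
    by (intro sum.cong refl) (simp add: ortho_gram_def Let_def g_def N_def as_def)
  finally show "0 \<le> (\<Sum>i<dim_row (ortho_gram k \<epsilon> \<phi>). \<Sum>j<dim_row (ortho_gram k \<epsilon> \<phi>).
      f i * ortho_gram k \<epsilon> \<phi> $$ (i, j) * f j)"
    unfolding dim .
qed

lemma ortho_mult_box_poly:
  assumes "\<forall>j. \<epsilon> j \<in> {0, 1}"
  shows "ortho \<epsilon> \<alpha> (\<chi> j. cos (t j)) * ortho \<epsilon> \<beta> (\<chi> j. cos (t j)) *
      mpoly_eval (box_poly \<epsilon>) (\<chi> j. cos (t j)) =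
    (\<Prod>j\<in>UNIV. trig (\<epsilon> j) (Poly_Mapping.lookup \<alpha> j) (t j) * trig (\<epsilon> j) (Poly_Mapping.lookup \<beta> j) (t j))"
proof -
  have "trig (\<epsilon> j) (Poly_Mapping.lookup \<alpha> j) (t j) * trig (\<epsilon> j) (Poly_Mapping.lookup \<beta> j) (t j) =
      poly (orthopoly (\<epsilon> j) (Poly_Mapping.lookup \<alpha> j)) (cos (t j)) *
      poly (orthopoly (\<epsilon> j) (Poly_Mapping.lookup \<beta> j)) (cos (t j)) * (1 - (cos (t j))\<^sup>2) ^ \<epsilon> j" for j
    using assms by (intro weighted_orthopoly_cos[symmetric]) simp
  then show ?thesis
    by (simp add: ortho_def mpoly_eval_box_poly prod.distrib)
qed

text \<open>Each index \<open>\<alpha>\<close> of degree at most \<open>n - |\<epsilon>|\<close> satisfies \<open>\<alpha>\<^sub>j + \<epsilon>\<^sub>j \<le> n\<close>, which is just the range in which the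
nodes see the univariate polynomials as orthonormal. This is why the size of the moment matrices is
reduced by \<open>d\<^sub>g\<close>.\<close>

lemma ortho_gram_gauss_chebyshev:
  fixes \<epsilon> :: "'d::finite \<Rightarrow> nat"
  assumes \<epsilon>: "\<epsilon> \<in> box_exponents n"
  shows "ortho_gram (n - (\<Sum>j\<in>UNIV. \<epsilon> j)) \<epsilon> (gauss_chebyshev_prod n) =
    1\<^sub>m (length (multi_indices (n - (\<Sum>j\<in>UNIV. \<epsilon> j)) :: 'd multi_index list))"
proof -
  define k where "k = n - (\<Sum>j\<in>UNIV. \<epsilon> j)"
  define as :: "'d multi_index list" where "as = multi_indices k"
  have \<epsilon>01: "\<epsilon> j \<in> {0, 1}" for j using \<epsilon> by (simp add: box_exponents_def)
  have bound: "Poly_Mapping.lookup \<alpha> j + \<epsilon> j \<le> n" if "mi_degree \<alpha> \<le> k" for \<alpha> j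
  proof -
    have "\<epsilon> j \<le> (\<Sum>j\<in>UNIV. \<epsilon> j)" by (rule member_le_sum) auto
    moreover have "(\<Sum>j\<in>UNIV. \<epsilon> j) \<le> n" using \<epsilon> by (simp add: box_exponents_def)
    ultimately show ?thesis
      using that lookup_le_mi_degree[of \<alpha> j] unfolding k_def by linarith
  qed
  have orth: "(\<integral>x. ortho \<epsilon> \<alpha> x * ortho \<epsilon> \<beta> x * mpoly_eval (box_poly \<epsilon>) x \<partial>gauss_chebyshev_prod n) =
      (if \<alpha> = \<beta> then 1 else 0)" if \<alpha>: "mi_degree \<alpha> \<le> k" and \<beta>: "mi_degree \<beta> \<le> k" for \<alpha> \<beta>
  proof -
    let ?f = "\<lambda>j t. poly (orthopoly (\<epsilon> j) (Poly_Mapping.lookup \<alpha> j)) t *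
      poly (orthopoly (\<epsilon> j) (Poly_Mapping.lookup \<beta> j)) t * (1 - t\<^sup>2) ^ \<epsilon> j"
    have "continuous_on UNIV (?f j)" for j by (intro continuous_intros)
    then have meas: "?f j \<in> borel_measurable borel" for j by (rule borel_measurable_continuous_onI)
    have "(\<integral>x. ortho \<epsilon> \<alpha> x * ortho \<epsilon> \<beta> x * mpoly_eval (box_poly \<epsilon>) x \<partial>gauss_chebyshev_prod n) =
        (\<integral>x. (\<Prod>j\<in>UNIV. ?f j (x $ j)) \<partial>gauss_chebyshev_prod n)"
      by (simp add: ortho_def mpoly_eval_box_poly prod.distrib)
    also have "\<dots> = (\<Prod>j\<in>UNIV. (\<Sum>i=1..n+1. ?f j (chebyshev_node n i)) / (real n + 1))"
      by (rule gauss_chebyshev_prod_integral_prod[OF meas])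
    also have "\<dots> = (\<Prod>j\<in>UNIV. if Poly_Mapping.lookup \<alpha> j = Poly_Mapping.lookup \<beta> j then 1 else 0)"
      unfolding chebyshev_node_cos weighted_orthopoly_cos[OF \<epsilon>01]
        sum_trig[OF \<epsilon>01 bound[OF \<alpha>] bound[OF \<beta>]]
      by (intro prod.cong) auto
    also have "\<dots> = (if \<alpha> = \<beta> then 1 else 0)"
    proof (cases "\<alpha> = \<beta>")
      case False
      then obtain j where "Poly_Mapping.lookup \<alpha> j \<noteq> Poly_Mapping.lookup \<beta> j"
        using poly_mapping_eqI[of \<alpha> \<beta>] by auto
      then have "(\<Prod>j\<in>UNIV. if Poly_Mapping.lookup \<alpha> j = Poly_Mapping.lookup \<beta> j then 1 else 0 :: real) = 0"
        by (intro prod_zero bexI[of _ j]) auto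
      then show ?thesis using False by simp
    qed simp
    finally show ?thesis .
  qed
  have deg: "mi_degree (as ! i) \<le> k" if "i < length as" for i
    using nth_mem[OF that] multi_indices(2)[of k, where 'd = 'd] unfolding as_def by blast
  have "distinct as" unfolding as_def by (rule multi_indices(1))
  then have "ortho_gram k \<epsilon> (gauss_chebyshev_prod n) = 1\<^sub>m (length as)"
    unfolding ortho_gram_def Let_def as_def[symmetric]
    by (intro eq_matI) (auto simp: orth deg nth_eq_iff_index_eq)
  then show ?thesis by (simp add: k_def as_def)
qed

text \<open>The trace of \<open>ortho_gram k \<epsilon> \<phi>\<close> minus its size.\<close>

definition trace_excess :: "nat \<Rightarrow> ('d::finite \<Rightarrow> nat) \<Rightarrow> (real^'d) measure \<Rightarrow> real" where
  "trace_excess k \<epsilon> \<phi> = (\<Sum>\<alpha> | mi_degree \<alpha> \<le> k.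
     (\<integral>x. ortho \<epsilon> \<alpha> x * ortho \<epsilon> \<alpha> x * mpoly_eval (box_poly \<epsilon>) x \<partial>\<phi>) - 1)"

text \<open>Since the Gram matrix of the Gauss-Chebyshev measure is the identity, the constant relating moment and
Gram determinants is the inverse of the moment determinant of that measure. The tangent inequality for
the Gram matrix of \<open>\<phi>\<close> then compares the two logarithmic determinants; a singular moment matrix has
\<open>log_det\<close> equal to \<open>-\<infinity>\<close> and needs no comparison.\<close>

lemma log_det_moment_matrix_le:
  fixes \<epsilon> :: "'d::finite \<Rightarrow> nat"
  assumes \<phi>: "\<phi> \<in> borel_prob_measures cube" and \<epsilon>: "\<epsilon> \<in> box_exponents n"
    and k: "k = n - (\<Sum>j\<in>UNIV. \<epsilon> j)"
  shows "\<exists>c. log_det (moment_matrix k (box_poly \<epsilon>) (gauss_chebyshev_prod n)) = ereal c \<and>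
    log_det (moment_matrix k (box_poly \<epsilon>) \<phi>) \<le> ereal (c + trace_excess k \<epsilon> \<phi>)"
proof -
  let ?\<nu> = "gauss_chebyshev_prod n :: (real^'d) measure"
  define as :: "'d multi_index list" where "as = multi_indices k"
  define N where "N = length as"
  define G where "G = ortho_gram k \<epsilon> \<phi>"
  define T where "T = (Determinant.det (change_of_basis k \<epsilon>))\<^sup>2"
  define m where "m = Determinant.det (moment_matrix k (box_poly \<epsilon>) ?\<nu>)"
  define l where "l = Determinant.det (moment_matrix k (box_poly \<epsilon>) \<phi>)"
  have "1 = T * m"
    using det_ortho_gram[OF gauss_chebyshev_prod_in[of n], of k \<epsilon>] ortho_gram_gauss_chebyshev[OF \<epsilon>]
    by (simp add: T_def m_def k)
  then have T: "0 < T" and m: "m = 1 / T"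
    by (auto simp: T_def eq_divide_eq mult.commute)
  have G: "G \<in> carrier_mat N N" by (simp add: G_def ortho_gram_def Let_def N_def as_def)
  have Gij: "G $$ (i, j) = (\<integral>x. ortho \<epsilon> (as ! i) x * ortho \<epsilon> (as ! j) x * mpoly_eval (box_poly \<epsilon>) x \<partial>\<phi>)"
    if "i < N" "j < N" for i j
    using that by (simp add: G_def ortho_gram_def Let_def N_def as_def)
  have detG: "Determinant.det G = T * l"
    using det_ortho_gram[OF \<phi>] by (simp add: G_def T_def l_def)
  have tr: "(\<Sum>i<N. G $$ (i, i) - 1) = trace_excess k \<epsilon> \<phi>"
    unfolding trace_excess_def
    by (subst sum_multi_indices_nth[symmetric]) (simp add: Gij N_def as_def)
  have "log_det (moment_matrix k (box_poly \<epsilon>) ?\<nu>) = ereal (- ln T)"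
    using T m by (simp add: log_det_def ln_div flip: m_def)
  moreover have "log_det (moment_matrix k (box_poly \<epsilon>) \<phi>) \<le> ereal (- ln T + trace_excess k \<epsilon> \<phi>)"
  proof (cases "l = 0")
    case True
    then show ?thesis by (simp add: log_det_def l_def)
  next
    case False
    have sym: "G $$ (i, j) = G $$ (j, i)" if "i < N" "j < N" for i j
      using that by (simp add: Gij mult_ac)
    have "Determinant.det G \<noteq> 0" using False T detG by simp
    note le = ln_det_le_trace[OF G sym psd_ortho_gram[OF \<phi>, of k \<epsilon>, folded G_def] this]
    have "0 < l" using le(1) T by (simp add: detG zero_less_mult_iff)
    then have "ln l = - ln T + ln (Determinant.det G)"
      using T by (simp add: detG ln_mult)
    then show ?thesis using le(2) False by (simp add: tr log_det_def flip: l_def)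
  qed
  ultimately show ?thesis by blast
qed

text \<open>Grouping the pairs \<open>(\<epsilon>, \<alpha>)\<close> by \<open>\<beta> = \<alpha> + \<epsilon>\<close>: the pairs with a given \<open>\<beta>\<close> arise by choosing \<open>\<epsilon>\<^sub>j \<in> {0, 1}\<close> with
\<open>\<epsilon>\<^sub>j \<le> \<beta>\<^sub>j\<close> independently in each variable, and the constraints on degrees become \<open>|\<beta>| \<le> n\<close>.\<close>

lemma sum_box_exponents_regroup:
  fixes q :: "nat \<Rightarrow> nat \<Rightarrow> 'd::finite \<Rightarrow> real"
  shows "(\<Sum>\<epsilon>\<in>box_exponents n. \<Sum>\<alpha> | mi_degree \<alpha> \<le> n - (\<Sum>j\<in>UNIV. \<epsilon> j).
      \<Prod>j\<in>UNIV. q (\<epsilon> j) (Poly_Mapping.lookup \<alpha> j) j) =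
    (\<Sum>\<beta> | mi_degree \<beta> \<le> n. \<Prod>j\<in>UNIV. \<Sum>e\<in>{..min 1 (Poly_Mapping.lookup \<beta> j)}.
      q e (Poly_Mapping.lookup \<beta> j - e) j)" (is "?L = ?R")
proof -
  let ?A = "Sigma (box_exponents n) (\<lambda>\<epsilon>. {\<alpha> :: 'd multi_index. mi_degree \<alpha> \<le> n - (\<Sum>j\<in>UNIV. \<epsilon> j)})"
  let ?E = "\<lambda>\<beta> :: 'd multi_index. Pi\<^sub>E UNIV (\<lambda>j. {..min 1 (Poly_Mapping.lookup \<beta> j)})"
  let ?B = "Sigma {\<beta> :: 'd multi_index. mi_degree \<beta> \<le> n} ?E"
  have "?L = (\<Sum>(\<epsilon>, \<alpha>)\<in>?A. \<Prod>j\<in>UNIV. q (\<epsilon> j) (Poly_Mapping.lookup \<alpha> j) j)"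
    by (rule sum.Sigma) (auto simp: finite_box_exponents finite_mi_degree_le)
  also have "\<dots> = (\<Sum>(\<beta>, \<epsilon>)\<in>?B. \<Prod>j\<in>UNIV. q (\<epsilon> j) (Poly_Mapping.lookup \<beta> j - \<epsilon> j) j)"
  proof (rule sum.reindex_bij_witness[where
        i = "\<lambda>(\<beta>, \<epsilon>). (\<epsilon>, Abs_poly_mapping (\<lambda>j. Poly_Mapping.lookup \<beta> j - \<epsilon> j))" and
        j = "\<lambda>(\<epsilon>, \<alpha>). (Abs_poly_mapping (\<lambda>j. Poly_Mapping.lookup \<alpha> j + \<epsilon> j), \<epsilon>)"], goal_cases)
    case (1 a)
    then show ?case by (auto simp: lookup_Abs_finite intro: poly_mapping_eqI)
  next
    case (2 a)
    then obtain \<epsilon> \<alpha> where a: "a = (\<epsilon>, \<alpha>)" and \<epsilon>: "\<forall>j. \<epsilon> j \<in> {0, 1}" "(\<Sum>j\<in>UNIV. \<epsilon> j) \<le> n"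
      and \<alpha>: "(\<Sum>j\<in>UNIV. Poly_Mapping.lookup \<alpha> j) \<le> n - (\<Sum>j\<in>UNIV. \<epsilon> j)"
      by (auto simp: box_exponents_def mi_degree_def)
    have "\<epsilon> j \<le> min 1 (Poly_Mapping.lookup \<alpha> j + \<epsilon> j)" for j
      using \<epsilon>(1)[rule_format, of j] by auto
    then show ?case
      using \<epsilon>(2) \<alpha> by (simp add: a mi_degree_def lookup_Abs_finite sum.distrib PiE_UNIV_domain)
  next
    case (3 b)
    then obtain \<beta> \<epsilon> where b: "b = (\<beta>, \<epsilon>)" and \<epsilon>: "\<forall>j. \<epsilon> j \<le> min 1 (Poly_Mapping.lookup \<beta> j)"
      by (auto simp: PiE_iff)
    have "Poly_Mapping.lookup \<beta> j - \<epsilon> j + \<epsilon> j = Poly_Mapping.lookup \<beta> j" for j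
      using \<epsilon>[rule_format, of j] by simp
    then show ?case by (auto simp: b lookup_Abs_finite intro: poly_mapping_eqI)
  next
    case (4 b)
    then obtain \<beta> \<epsilon> where b: "b = (\<beta>, \<epsilon>)" and \<epsilon>: "\<forall>j. \<epsilon> j \<le> min 1 (Poly_Mapping.lookup \<beta> j)"
      and \<beta>: "(\<Sum>j\<in>UNIV. Poly_Mapping.lookup \<beta> j) \<le> n"
      by (auto simp: PiE_iff mi_degree_def)
    have le: "\<epsilon> j \<le> Poly_Mapping.lookup \<beta> j" "\<epsilon> j \<le> 1" for j
      using \<epsilon>[rule_format, of j] by auto
    have "\<epsilon> j \<in> {0, 1}" for j using le(2)[of j] by auto
    moreover have "(\<Sum>j\<in>UNIV. \<epsilon> j) \<le> (\<Sum>j\<in>UNIV. Poly_Mapping.lookup \<beta> j)"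
      using le(1) by (rule sum_mono)
    ultimately show ?case
      using \<beta> le(1) by (simp add: b mi_degree_def lookup_Abs_finite box_exponents_def sum_subtractf_nat diff_le_mono)
  next
    case (5 a)
    then show ?case by (auto simp: lookup_Abs_finite)
  qed
  also have "\<dots> = (\<Sum>\<beta> | mi_degree \<beta> \<le> n. \<Sum>\<epsilon>\<in>?E \<beta>.
      \<Prod>j\<in>UNIV. q (\<epsilon> j) (Poly_Mapping.lookup \<beta> j - \<epsilon> j) j)"
    by (rule sum.Sigma[symmetric]) (auto simp: finite_mi_degree_le intro!: finite_PiE)
  also have "\<dots> = ?R"
    by (intro sum.cong refl prod_sum_PiE[symmetric]) auto
  finally show ?thesis .
qed

text \<open>A multivariate form of Pell's equation for Chebyshev polynomials. After the substitution \<open>x = cos t\<close> the sum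
for fixed \<open>\<beta> = \<alpha> + \<epsilon>\<close> factors over the variables, and the factor of a variable is \<open>1\<close> if \<open>\<beta>\<^sub>j = 0\<close> and
\<open>2 cos\<^sup>2 (\<beta>\<^sub>j t\<^sub>j) + 2 sin\<^sup>2 (\<beta>\<^sub>j t\<^sub>j) = 2\<close> otherwise. In both cases it is the number of choices for \<open>\<epsilon>\<^sub>j\<close>, so the
sum of the squares equals the number of its summands.\<close>

lemma sum_ortho_squares:
  fixes x :: "real^'d::finite"
  assumes x: "x \<in> cube"
  shows "(\<Sum>\<epsilon>\<in>box_exponents n. \<Sum>\<alpha> | mi_degree \<alpha> \<le> n - (\<Sum>j\<in>UNIV. \<epsilon> j).
      ortho \<epsilon> \<alpha> x * ortho \<epsilon> \<alpha> x * mpoly_eval (box_poly \<epsilon>) x) =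
    (\<Sum>\<epsilon> :: 'd \<Rightarrow> nat\<in>box_exponents n.
      \<Sum>\<alpha> :: 'd multi_index | mi_degree \<alpha> \<le> n - (\<Sum>j\<in>UNIV. \<epsilon> j). 1)"
proof -
  define t where "t j = arccos (x $ j)" for j
  have x_cos: "x = (\<chi> j. cos (t j))"
    using x by (simp add: vec_eq_iff t_def cube_def)
  have "(\<Sum>\<epsilon>\<in>box_exponents n. \<Sum>\<alpha> | mi_degree \<alpha> \<le> n - (\<Sum>j\<in>UNIV. \<epsilon> j).
      ortho \<epsilon> \<alpha> x * ortho \<epsilon> \<alpha> x * mpoly_eval (box_poly \<epsilon>) x) =
    (\<Sum>\<epsilon>\<in>box_exponents n. \<Sum>\<alpha> | mi_degree \<alpha> \<le> n - (\<Sum>j\<in>UNIV. \<epsilon> j).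
      \<Prod>j\<in>UNIV. (trig (\<epsilon> j) (Poly_Mapping.lookup \<alpha> j) (t j))\<^sup>2)"
    unfolding x_cos power2_eq_square
    by (intro sum.cong refl ortho_mult_box_poly) (simp add: box_exponents_def)
  also have "\<dots> = (\<Sum>\<beta> | mi_degree \<beta> \<le> n. \<Prod>j\<in>UNIV. \<Sum>e\<in>{..min 1 (Poly_Mapping.lookup \<beta> j)}.
      (trig e (Poly_Mapping.lookup \<beta> j - e) (t j))\<^sup>2)"
    by (rule sum_box_exponents_regroup[where q = "\<lambda>e a j. (trig e a (t j))\<^sup>2"])
  also have "\<dots> = (\<Sum>\<beta> :: 'd multi_index | mi_degree \<beta> \<le> n.
      \<Prod>j\<in>UNIV. \<Sum>e\<in>{..min 1 (Poly_Mapping.lookup \<beta> j)}. 1)"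
  proof (rule sum.cong[OF refl], rule prod.cong[OF refl])
    fix \<beta> :: "'d multi_index" and j
    have "(\<Sum>e\<le>min 1 b. (trig e (b - e) s)\<^sup>2) = (\<Sum>e\<le>min 1 b. (1 :: real))" for b s
    proof (cases b)
      case (Suc c)
      have "2 * (cos (real (Suc c) * s))\<^sup>2 + 2 * (sin (real (Suc c) * s))\<^sup>2 = 2"
        unfolding distrib_left[symmetric] by simp
      then show ?thesis using Suc by (simp add: trig_def power_mult_distrib)
    qed (simp add: trig_def)
    then show "(\<Sum>e\<in>{..min 1 (Poly_Mapping.lookup \<beta> j)}. (trig e (Poly_Mapping.lookup \<beta> j - e) (t j))\<^sup>2) =
        (\<Sum>e\<in>{..min 1 (Poly_Mapping.lookup \<beta> j)}. 1)" .
  qed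
  also have "\<dots> = (\<Sum>\<epsilon> :: 'd \<Rightarrow> nat\<in>box_exponents n.
      \<Sum>\<alpha> :: 'd multi_index | mi_degree \<alpha> \<le> n - (\<Sum>j\<in>UNIV. \<epsilon> j). \<Prod>j\<in>(UNIV :: 'd set). 1)"
    by (rule sum_box_exponents_regroup[where q = "\<lambda>_ _ (_ :: 'd). 1", symmetric])
  finally show ?thesis by simp
qed

text \<open>Integrating the preceding identity: summed over all weights, the first-order terms of the tangent
inequalities cancel for every probability measure on the cube.\<close>

lemma sum_trace_excess:
  fixes \<phi> :: "(real^'d::finite) measure"
  assumes \<phi>: "\<phi> \<in> borel_prob_measures cube"
  shows "(\<Sum>\<epsilon>\<in>box_exponents n. trace_excess (n - (\<Sum>j\<in>UNIV. \<epsilon> j)) \<epsilon> \<phi>) = 0"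
proof -
  interpret prob_space \<phi> using \<phi> by (simp add: borel_prob_measures_def)
  let ?S = "\<lambda>\<epsilon> :: 'd \<Rightarrow> nat. {\<alpha> :: 'd multi_index. mi_degree \<alpha> \<le> n - (\<Sum>j\<in>UNIV. \<epsilon> j)}"
  let ?q = "\<lambda>\<epsilon> \<alpha> x. ortho \<epsilon> \<alpha> x * ortho \<epsilon> \<alpha> x * mpoly_eval (box_poly \<epsilon>) (x :: real^'d)"
  have "(\<Sum>\<epsilon>\<in>box_exponents n. \<Sum>\<alpha>\<in>?S \<epsilon>. \<integral>x. ?q \<epsilon> \<alpha> x \<partial>\<phi>) =
      (\<integral>x. (\<Sum>\<epsilon>\<in>box_exponents n. \<Sum>\<alpha>\<in>?S \<epsilon>. ?q \<epsilon> \<alpha> x) \<partial>\<phi>)"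
    by (subst integral_double_sum[OF \<phi>]) (auto intro!: continuous_intros)
  also have "\<dots> = (\<integral>x. (\<Sum>\<epsilon> :: 'd \<Rightarrow> nat\<in>box_exponents n. \<Sum>\<alpha>\<in>?S \<epsilon>. 1) \<partial>\<phi>)"
    by (intro Bochner_Integration.integral_cong refl sum_ortho_squares)
      (simp add: space_borel_prob_measures[OF \<phi>])
  also have "\<dots> = (\<Sum>\<epsilon> :: 'd \<Rightarrow> nat\<in>box_exponents n. \<Sum>\<alpha>\<in>?S \<epsilon>. 1)"
    by (simp add: prob_space)
  finally show ?thesis
    by (simp add: trace_excess_def sum_subtractf)
qed

lemma logdet_objective_eq:
  fixes \<phi> :: "(real^'d::finite) measure"
  shows "logdet_objective n \<phi> = (\<Sum>\<epsilon>\<in>box_exponents n.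
    log_det (moment_matrix (n - (\<Sum>j\<in>UNIV. \<epsilon> j)) (box_poly \<epsilon>) \<phi>))"
proof -
  have "half_degree (box_poly \<epsilon>) = (\<Sum>j\<in>UNIV. \<epsilon> j)" if "\<epsilon> \<in> box_exponents n" for \<epsilon> :: "'d \<Rightarrow> nat"
    using that by (intro half_degree_box_poly) (simp add: box_exponents_def)
  then show ?thesis
    unfolding logdet_objective_def G_box_eq by (simp add: sum.reindex[OF inj_on_box_poly])
qed

lemma logdet_objective_le:
  fixes \<phi> :: "(real^'d::finite) measure"
  assumes \<phi>: "\<phi> \<in> borel_prob_measures cube"
  shows "logdet_objective n \<phi> \<le> logdet_objective n (gauss_chebyshev_prod n :: (real^'d) measure)"
proof -
  let ?k = "\<lambda>\<epsilon> :: 'd \<Rightarrow> nat. n - (\<Sum>j\<in>UNIV. \<epsilon> j)"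
  have "\<forall>\<epsilon>\<in>box_exponents n. \<exists>c.
      log_det (moment_matrix (?k \<epsilon>) (box_poly \<epsilon>) (gauss_chebyshev_prod n)) = ereal c \<and>
      log_det (moment_matrix (?k \<epsilon>) (box_poly \<epsilon>) \<phi>) \<le> ereal (c + trace_excess (?k \<epsilon>) \<epsilon> \<phi>)"
    using log_det_moment_matrix_le[OF \<phi> _ refl] by simp
  from bchoice[OF this] obtain c where c: "\<forall>\<epsilon>\<in>box_exponents n.
      log_det (moment_matrix (?k \<epsilon>) (box_poly \<epsilon>) (gauss_chebyshev_prod n)) = ereal (c \<epsilon>) \<and>
      log_det (moment_matrix (?k \<epsilon>) (box_poly \<epsilon>) \<phi>) \<le> ereal (c \<epsilon> + trace_excess (?k \<epsilon>) \<epsilon> \<phi>)" ..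
  have "logdet_objective n \<phi> \<le> (\<Sum>\<epsilon>\<in>box_exponents n. ereal (c \<epsilon> + trace_excess (?k \<epsilon>) \<epsilon> \<phi>))"
    unfolding logdet_objective_eq using c by (intro sum_mono) blast
  also have "\<dots> = ereal (\<Sum>\<epsilon>\<in>box_exponents n. c \<epsilon>)"
    using sum_trace_excess[OF \<phi>, of n] by (simp add: sum.distrib)
  also have "\<dots> = (\<Sum>\<epsilon>\<in>box_exponents n. ereal (c \<epsilon>))" by simp
  also have "\<dots> = logdet_objective n (gauss_chebyshev_prod n :: (real^'d) measure)"
    unfolding logdet_objective_eq by (rule sum.cong[OF refl]) (use c in auto)
  finally show ?thesis .
qed


section \<open>Convergence to the equilibrium measure\<close>

text \<open>Lebesgue measure on a Euclidean space is the image of a product indexed by the basis vectors; the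
product over the basis is turned into a product over coordinates.\<close>

lemma integral_lborel_prod_vec:
  fixes f :: "'d::finite \<Rightarrow> real \<Rightarrow> real"
  assumes f: "\<And>j. integrable lborel (f j)"
  shows "(\<integral>x. (\<Prod>j\<in>UNIV. f j (x $ j)) \<partial>(lborel :: (real^'d) measure)) =
    (\<Prod>j\<in>UNIV. \<integral>t. f j t \<partial>lborel)"
proof -
  let ?e = "\<lambda>j :: 'd. axis j (1 :: real)"
  define ix where "ix = inv_into UNIV ?e"
  have inj: "inj ?e" by (auto simp: inj_def axis_eq_axis)
  have ix: "ix (?e j) = j" for j unfolding ix_def using inj by (rule inv_f_f)
  have Basis: "(Basis :: (real^'d) set) = range ?e" by (auto simp: Basis_vec_def)
  interpret product_sigma_finite "\<lambda>_ :: real^'d. lborel :: real measure"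
    by (intro product_sigma_finite.intro lborel.sigma_finite_measure_axioms)
  have [measurable]: "f j \<in> borel_measurable borel" for j
    using borel_measurable_integrable[OF f] by simp
  have nth: "(\<Sum>b\<in>Basis. z b *\<^sub>R b) $ j = z (?e j)" for z :: "real^'d \<Rightarrow> real" and j
  proof -
    have "(\<Sum>b\<in>Basis. z b *\<^sub>R b) $ j = (\<Sum>i\<in>UNIV. z (?e i) * (?e i $ j))"
      unfolding Basis using inj by (simp add: sum.reindex)
    also have "\<dots> = (\<Sum>i\<in>UNIV. if i = j then z (?e j) else 0)"
      by (intro sum.cong) (auto simp: axis_def)
    finally show ?thesis by simp
  qed
  have "(\<integral>x. (\<Prod>j\<in>UNIV. f j (x $ j)) \<partial>(lborel :: (real^'d) measure)) =
      (\<integral>z. (\<Prod>j\<in>UNIV. f j (z (?e j))) \<partial>(\<Pi>\<^sub>M b\<in>(Basis :: (real^'d) set). lborel))"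
    by (subst lborel_eq, subst integral_distr) (simp_all add: nth del: sum_component)
  also have "\<dots> = (\<integral>z. (\<Prod>b\<in>Basis. f (ix b) (z b)) \<partial>(\<Pi>\<^sub>M b\<in>(Basis :: (real^'d) set). lborel))"
    unfolding Basis using inj by (simp add: prod.reindex ix)
  also have "\<dots> = (\<Prod>b\<in>(Basis :: (real^'d) set). \<integral>t. f (ix b) t \<partial>lborel)"
    by (intro product_integral_prod) (auto intro: f)
  also have "\<dots> = (\<Prod>j\<in>UNIV. \<integral>t. f j t \<partial>lborel)"
    unfolding Basis using inj by (simp add: prod.reindex ix)
  finally show ?thesis .
qed

text \<open>At the end points the denominator vanishes, so that the density takes the value 0 there, in agreement
with the density of the equilibrium measure.\<close>

definition arcsine_density :: "real \<Rightarrow> real" where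
  "arcsine_density t = indicator {-1..1} t / (pi * sqrt (1 - t\<^sup>2))"

lemma arcsine_density_eq:
  "arcsine_density t = indicator {-1<..<1} t *\<^sub>R (1 / (pi * sqrt (1 - t\<^sup>2)))"
  by (cases "t = 1 \<or> t = -1") (auto simp: arcsine_density_def indicator_def)

lemma arcsine_density_measurable [measurable]: "arcsine_density \<in> borel_measurable borel"
  unfolding arcsine_density_def by measurable

lemma DERIV_arccos': "-1 < x \<Longrightarrow> x < 1 \<Longrightarrow> DERIV arccos x :> - (1 / sqrt (1 - x\<^sup>2))"
  using DERIV_arccos[of x] by (simp add: inverse_eq_divide)

text \<open>The substitution \<open>x = cos t\<close> in the form of the fundamental theorem of calculus for the antiderivative
\<open>- h (arccos x) / \<pi>\<close>, whose derivative is singular at the end points. Integrability has to be known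
beforehand, unless the integrand is nonnegative: applied to a constant integrand, the second case yields the
integrability of the density itself, and this in turn the first case for all polynomials.\<close>

lemma arccos_FTC:
  fixes h :: "real \<Rightarrow> real"
  assumes h: "continuous_on {0..pi} h" "\<And>t. DERIV h t :> h' t"
    and f: "\<And>x. -1 < x \<Longrightarrow> x < 1 \<Longrightarrow> f x = h' (arccos x)" "continuous_on UNIV f"
    and int: "integrable lborel (\<lambda>x. arcsine_density x * f x) \<or> (\<forall>x\<in>{-1<..<1}. 0 \<le> f x)"
  shows "integrable lborel (\<lambda>x. arcsine_density x * f x)"
    "(\<integral>x. arcsine_density x * f x \<partial>lborel) = (h pi - h 0) / pi"
proof -
  define F where "F x = h (arccos x) / (- pi)" for x
  define w where "w x = f x / (pi * sqrt (1 - x\<^sup>2))" for x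
  have wd: "arcsine_density x * f x = indicator (einterval (ereal (-1)) (ereal 1)) x *\<^sub>R w x" for x
    by (simp add: arcsine_density_eq w_def einterval_eq)
  have sq: "0 < 1 - x\<^sup>2" if "-1 < x" "x < 1" for x :: real
    using that abs_square_less_1[of x] by auto
  have F: "DERIV F x :> w x" if "-1 < x" "x < 1" for x
    unfolding F_def w_def f(1)[OF that]
    using DERIV_cdivide[OF DERIV_chain2[OF h(2) DERIV_arccos'[OF that]], of "- pi"]
    by (simp add: mult.commute)
  have w: "isCont w x" if "-1 < x" "x < 1" for x
    unfolding w_def using f(2) sq[OF that]
    by (intro continuous_intros) (auto simp: continuous_on_eq_continuous_at)
  have cF: "continuous_on {-1..1} F"
    unfolding F_def
    by (intro continuous_intros continuous_on_compose2[OF h(1)]) (auto simp: arccos_lbound arccos_ubound)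
  have A: "((F \<circ> real_of_ereal) \<longlongrightarrow> F (-1)) (at_right (ereal (-1)))"
    using continuous_on_Icc_at_rightD[OF cF] by (simp add: ereal_tendsto_simps)
  have B: "((F \<circ> real_of_ereal) \<longlongrightarrow> F 1) (at_left (ereal 1))"
    using continuous_on_Icc_at_leftD[OF cF] by (simp add: ereal_tendsto_simps)
  have lt: "ereal (-1) < ereal 1" by simp
  have F': "DERIV F x :> w x" "(F has_vector_derivative w x) (at x)" and w': "isCont w x"
    if "ereal (-1) < ereal x" "ereal x < ereal 1" for x
    using F[of x] w[of x] that by (simp_all add: has_real_derivative_iff_has_vector_derivative)
  have "set_integrable lborel (einterval (ereal (-1)) (ereal 1)) w \<and>
      (LBINT x=ereal (-1)..ereal 1. w x) = F 1 - F (-1)"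
    using int
  proof
    assume "integrable lborel (\<lambda>x. arcsine_density x * f x)"
    then have si: "set_integrable lborel (einterval (ereal (-1)) (ereal 1)) w"
      unfolding set_integrable_def wd .
    moreover have "(LBINT x=ereal (-1)..ereal 1. w x) = F 1 - F (-1)"
      by (rule interval_integral_FTC_integrable[OF lt F'(2) w' si A B])
    ultimately show ?thesis ..
  next
    assume "\<forall>x\<in>{-1<..<1}. 0 \<le> f x"
    then have "0 \<le> w x" if "-1 < x" "x < 1" for x
      using that sq[OF that] by (simp add: w_def)
    then have "AE x in lborel. ereal (-1) < ereal x \<longrightarrow> ereal x < ereal 1 \<longrightarrow> 0 \<le> w x"
      by simp
    from interval_integral_FTC_nonneg[OF lt F'(1) w' this A B]
    show ?thesis by (rule conjI)
  qed
  then show "integrable lborel (\<lambda>x. arcsine_density x * f x)"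
    "(\<integral>x. arcsine_density x * f x \<partial>lborel) = (h pi - h 0) / pi"
    unfolding wd by (auto simp: set_integrable_def interval_lebesgue_integral_def
        set_lebesgue_integral_def F_def diff_divide_distrib)
qed

lemma integrable_arcsine_density: "integrable lborel arcsine_density"
  using arccos_FTC(1)[of "\<lambda>t. t" "\<lambda>_. 1" "\<lambda>_. 1"] by simp

lemma integrable_arcsine_continuous:
  assumes g: "continuous_on UNIV g"
  shows "integrable lborel (\<lambda>x. arcsine_density x * g x)"
proof -
  have "bounded (g ` {-1..1})"
    using compact_continuous_image[OF continuous_on_subset[OF g]] compact_imp_bounded by blast
  then obtain B where "\<forall>x\<in>{-1..1}. \<bar>g x\<bar> \<le> B"
    unfolding bounded_iff by auto
  then have B: "\<bar>g x\<bar> \<le> B" if "x \<in> {-1..1}" for x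
    using that by blast
  have [measurable]: "g \<in> borel_measurable borel" using g by (rule borel_measurable_continuous_onI)
  show ?thesis
  proof (rule Bochner_Integration.integrable_bound)
    show "integrable lborel (\<lambda>x. B * arcsine_density x)"
      using integrable_arcsine_density by simp
    have "\<bar>arcsine_density x * g x\<bar> \<le> \<bar>B * arcsine_density x\<bar>" for x
    proof (cases "x \<in> {-1..1}")
      case True
      then have "\<bar>g x\<bar> \<le> \<bar>B\<bar>" using B[of x] by simp
      then show ?thesis by (simp add: abs_mult mult.commute[of "\<bar>B\<bar>"] mult_left_mono)
    qed (simp add: arcsine_density_def)
    then show "AE x in lborel. norm (arcsine_density x * g x) \<le> norm (B * arcsine_density x)"
      by simp
  qed measurable
qed

lemma integral_arcsine_chebyshev:
  "(\<integral>x. arcsine_density x * poly (chebyshev_poly 1 a) x \<partial>lborel) = (if a = 0 then 1 else 0)"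
proof (cases "a = 0")
  case True
  then show ?thesis using arccos_FTC(2)[of "\<lambda>t. t" "\<lambda>_. 1" "\<lambda>_. 1"] by simp
next
  case False
  have "(\<integral>x. arcsine_density x * poly (chebyshev_poly 1 a) x \<partial>lborel) =
      (sin (real a * pi) / real a - sin (real a * 0) / real a) / pi"
  proof (rule arccos_FTC(2)[where h' = "\<lambda>t. cos (real a * t)"])
    show "poly (chebyshev_poly 1 a) x = cos (real a * arccos x)" if "-1 < x" "x < 1" for x
      using chebyshev_first_kind[of a "arccos x"] that by simp
    show "DERIV (\<lambda>t. sin (real a * t) / real a) t :> cos (real a * t)" for t
      using False by (auto intro!: derivative_eq_intros)
    show "continuous_on UNIV (poly (chebyshev_poly 1 a))" by (intro continuous_intros)
    then show "integrable lborel (\<lambda>x. arcsine_density x * poly (chebyshev_poly 1 a) x) \<or>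
      (\<forall>x\<in>{-1<..<1}. 0 \<le> poly (chebyshev_poly 1 a) x)"
      by (auto intro: integrable_arcsine_continuous)
  qed (use False in \<open>intro continuous_intros; simp\<close>)
  then show ?thesis using False by simp
qed

text \<open>Exactness on \<open>T\<^sub>a\<close> for \<open>a \<le> 2 n + 1\<close> is the vanishing of the cosine sums. It is carried over to powers of
\<open>x\<close> by induction on \<open>k\<close>, for all products \<open>x\<^sup>k T\<^sub>a\<close> simultaneously: the recurrence
\<open>x T\<^sub>a = (T\<^bsub>a+1\<^esub> + T\<^bsub>a-1\<^esub>) / 2\<close> for \<open>a > 0\<close>, together with \<open>x T\<^sub>0 = T\<^sub>1\<close>,
trades a factor \<open>x\<close> for a shift of \<open>a\<close>.\<close>

lemma gauss_chebyshev_quadrature: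
  assumes "k \<le> 2 * n + 1"
  shows "(\<Sum>i=1..n+1. chebyshev_node n i ^ k) / (real n + 1) = (\<integral>x. arcsine_density x * x ^ k \<partial>lborel)"
proof -
  \<comment> \<open>The quadrature error, a linear functional.\<close>
  define L where "L q = (\<Sum>i=1..n+1. poly q (chebyshev_node n i)) / (real n + 1) -
    (\<integral>x. arcsine_density x * poly q x \<partial>lborel)" for q
  have int: "integrable lborel (\<lambda>x. arcsine_density x * poly q x)" for q
    by (intro integrable_arcsine_continuous continuous_intros)
  have L_add: "L (p + q) = L p + L q" for p q
    by (simp add: L_def distrib_left sum.distrib add_divide_distrib Bochner_Integration.integral_add[OF int int])
  have L_smult: "L (Polynomial.smult c q) = c * L q" for c q
    by (simp add: L_def right_diff_distrib mult.left_commute flip: sum_distrib_left)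
  have "a + k \<le> 2 * n + 1 \<Longrightarrow> L (monom 1 k * chebyshev_poly 1 a) = 0" for a
  proof (induction k arbitrary: a)
    case 0
    then show ?case
      using integral_arcsine_chebyshev[of a] sum_cos_angles[of a n]
      by (cases "a = 0") (auto simp: L_def chebyshev_node_cos chebyshev_first_kind simp del: sum.cl_ivl_Suc)
  next
    case (Suc k)
    have monom: "monom 1 (Suc k) = monom 1 k * [:0, 1 :: real:]"
      by (simp add: monom_Suc)
    show ?case
    proof (cases a)
      case 0
      then show ?thesis
        using Suc.IH[of 1] Suc.prems by (simp add: monom_Suc)
    next
      case (Suc b)
      have "monom 1 (Suc k) * chebyshev_poly 1 a =
          Polynomial.smult (1 / 2) (monom 1 k * chebyshev_poly 1 (Suc a) + monom 1 k * chebyshev_poly 1 b)"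
        unfolding monom Suc chebyshev_poly.simps by (simp add: algebra_simps)
      then show ?thesis
        using Suc.IH[of "Suc a"] Suc.IH[of b] Suc.prems Suc by (simp only: L_smult L_add) simp
    qed
  qed
  from this[of 0] assms have "L (monom 1 k) = 0" by simp
  then show ?thesis by (simp add: L_def poly_monom)
qed

lemma indicator_cube: "indicator cube x = (\<Prod>j\<in>UNIV. indicator {-1..1} (x $ j) :: real)"
proof (cases "x \<in> cube")
  case False
  then obtain j where "x $ j \<notin> {-1..1}" by (auto simp: cube_def)
  then have "(\<Prod>j\<in>UNIV. indicator {-1..1} (x $ j) :: real) = 0"
    by (intro prod_zero bexI[of _ j]) auto
  then show ?thesis using False by simp
qed (simp add: cube_def)

lemma sqrt_prod: "sqrt (\<Prod>j\<in>A. f j) = (\<Prod>j\<in>A. sqrt (f j))"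
  by (induction A rule: infinite_finite_induct) (auto simp: real_sqrt_mult)

lemma cube_borel [measurable]: "cube \<in> sets borel"
  unfolding cube_eq_cbox by simp

lemma integral_equilibrium_prod:
  fixes f :: "'d::finite \<Rightarrow> real \<Rightarrow> real"
  assumes f: "\<And>j. continuous_on UNIV (f j)"
  shows "(\<integral>x. (\<Prod>j\<in>UNIV. f j (x $ j)) \<partial>(equilibrium_measure :: (real^'d) measure)) =
    (\<Prod>j\<in>UNIV. \<integral>t. arcsine_density t * f j t \<partial>lborel)"
proof -
  have [measurable]: "f j \<in> borel_measurable borel" for j
    using f by (rule borel_measurable_continuous_onI)
  let ?w = "\<lambda>x :: real^'d. 1 / (pi ^ CARD('d) * sqrt (\<Prod>j\<in>UNIV. 1 - (x $ j)\<^sup>2))"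
  have nonneg: "AE x in restrict_space lborel cube. 0 \<le> ?w x"
  proof (rule AE_I2)
    fix x :: "real^'d" assume "x \<in> space (restrict_space lborel cube)"
    then have "0 \<le> 1 - (x $ j)\<^sup>2" for j
      using abs_square_le_1[of "x $ j"] by (auto simp: space_restrict_space cube_def abs_le_iff)
    then show "0 \<le> ?w x" by (simp add: prod_nonneg)
  qed
  have m: "(\<lambda>x. \<Prod>j\<in>UNIV. f j (x $ j)) \<in> borel_measurable (restrict_space (lborel :: (real^'d) measure) cube)"
    "?w \<in> borel_measurable (restrict_space lborel cube)"
    by (rule measurable_restrict_space1, measurable)+
  have "(\<integral>x. (\<Prod>j\<in>UNIV. f j (x $ j)) \<partial>(equilibrium_measure :: (real^'d) measure)) =
      (\<integral>x. indicator cube x *\<^sub>R (?w x *\<^sub>R (\<Prod>j\<in>UNIV. f j (x $ j))) \<partial>lborel)"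
    unfolding equilibrium_measure_def integral_density[OF m nonneg]
    by (subst integral_restrict_space) auto
  also have "\<dots> = (\<integral>x. (\<Prod>j\<in>UNIV. arcsine_density (x $ j) * f j (x $ j)) \<partial>(lborel :: (real^'d) measure))"
    by (intro Bochner_Integration.integral_cong refl)
      (simp add: indicator_cube sqrt_prod arcsine_density_def prod.distrib prod_dividef)
  also have "\<dots> = (\<Prod>j\<in>UNIV. \<integral>t. arcsine_density t * f j t \<partial>lborel)"
    by (intro integral_lborel_prod_vec integrable_arcsine_continuous f)
  finally show ?thesis .
qed

text \<open>The total mass is obtained as a Bochner integral; a value different from 0 excludes infinite measure, for
which \<open>measure\<close> is 0 by convention.\<close>

lemma equilibrium_measure_in: "equilibrium_measure \<in> borel_prob_measures (cube :: (real^'d::finite) set)"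
proof -
  let ?\<phi> = "equilibrium_measure :: (real^'d) measure"
  have 1: "(\<integral>x. 1 \<partial>?\<phi>) = (1 :: real)"
    using integral_equilibrium_prod[of "\<lambda>(_ :: 'd) _. 1"] integral_arcsine_chebyshev[of 0] by simp
  then have "measure ?\<phi> (space ?\<phi>) = 1" by simp
  moreover from this have "emeasure ?\<phi> (space ?\<phi>) \<noteq> \<infinity>" by (auto simp: measure_def)
  ultimately have "emeasure ?\<phi> (space ?\<phi>) = 1"
    by (simp add: emeasure_eq_ennreal_measure)
  then have "prob_space ?\<phi>" by (rule prob_spaceI)
  moreover have "sets ?\<phi> = sets (restrict_space borel cube)"
    by (simp add: equilibrium_measure_def sets_restrict_space)
  ultimately show ?thesis by (simp add: borel_prob_measures_def)
qed

text \<open>Every exponent occurring in \<open>p\<close> is at most \<open>2 n + 1\<close>, so each monomial is integrated exactly in each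
variable.\<close>

lemma gauss_chebyshev_prod_exact:
  assumes "total_degree p \<le> 2 * n + 1"
  shows "(\<integral>x. mpoly_eval p x \<partial>(gauss_chebyshev_prod n :: (real^'d::finite) measure)) =
    (\<integral>x. mpoly_eval p x \<partial>equilibrium_measure)"
proof -
  have mono: "(\<integral>x. monomial_at \<alpha> x \<partial>(gauss_chebyshev_prod n :: (real^'d) measure)) =
      (\<integral>x. monomial_at \<alpha> x \<partial>equilibrium_measure)" if \<alpha>: "\<alpha> \<in> Poly_Mapping.keys p" for \<alpha>
  proof -
    have "mi_degree \<alpha> \<le> total_degree p"
      unfolding total_degree_def using \<alpha> by (intro Max_ge) auto
    then have "Poly_Mapping.lookup \<alpha> j \<le> 2 * n + 1" for j
      using member_le_sum[of j UNIV "Poly_Mapping.lookup \<alpha>"] assms by (simp add: mi_degree_def)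
    then have exact: "(\<Sum>i=1..n+1. chebyshev_node n i ^ Poly_Mapping.lookup \<alpha> j) / (real n + 1) =
        (\<integral>t. arcsine_density t * t ^ Poly_Mapping.lookup \<alpha> j \<partial>lborel)" for j
      by (intro gauss_chebyshev_quadrature)
    show ?thesis
      unfolding monomial_at_def
      by (subst gauss_chebyshev_prod_integral_prod, measurable, subst integral_equilibrium_prod)
        (auto intro!: continuous_intros simp only: exact)
  qed
  have "(\<integral>x. mpoly_eval p x \<partial>\<phi>) =
      (\<Sum>\<alpha>\<in>Poly_Mapping.keys p. Poly_Mapping.lookup p \<alpha> * (\<integral>x. monomial_at \<alpha> x \<partial>\<phi>))"
    if "\<phi> \<in> borel_prob_measures cube" for \<phi> :: "(real^'d) measure"
    unfolding mpoly_eval_def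
    by (subst Bochner_Integration.integral_sum)
      (auto intro!: integrable_continuous_on_cube[OF that] continuous_intros)
  then show ?thesis
    using gauss_chebyshev_prod_in equilibrium_measure_in mono by (metis (no_types, lifting) sum.cong)
qed

lemma integral_diff_le:
  fixes f g :: "real^'d::finite \<Rightarrow> real"
  assumes \<phi>: "\<phi> \<in> borel_prob_measures cube" and f: "continuous_on cube f" and g: "continuous_on cube g"
    and le: "\<And>x. x \<in> cube \<Longrightarrow> \<bar>f x - g x\<bar> \<le> e"
  shows "\<bar>(\<integral>x. f x \<partial>\<phi>) - (\<integral>x. g x \<partial>\<phi>)\<bar> \<le> e"
proof -
  interpret prob_space \<phi> using \<phi> by (simp add: borel_prob_measures_def)
  note int = integrable_continuous_on_cube[OF \<phi> f] integrable_continuous_on_cube[OF \<phi> g]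
  have "\<bar>(\<integral>x. f x \<partial>\<phi>) - (\<integral>x. g x \<partial>\<phi>)\<bar> = \<bar>\<integral>x. f x - g x \<partial>\<phi>\<bar>"
    using int by simp
  also have "\<dots> \<le> (\<integral>x. \<bar>f x - g x\<bar> \<partial>\<phi>)"
    by (rule integral_abs_bound)
  also have "\<dots> \<le> (\<integral>x. e \<partial>\<phi>)"
    using int le space_borel_prob_measures[OF \<phi>] by (intro integral_mono) auto
  finally show ?thesis by (simp add: prob_space)
qed

text \<open>Approximate \<open>f\<close> uniformly by a polynomial: its integrals against the atomic measures and against the
equilibrium measure coincide as soon as \<open>2 n + 1\<close> reaches its degree.\<close>

lemma gauss_chebyshev_prod_weak_limit:
  fixes f :: "real^'d::finite \<Rightarrow> real"
  assumes f: "continuous_on cube f"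
  shows "(\<lambda>n. \<integral>x. f x \<partial>gauss_chebyshev_prod n) \<longlonglongrightarrow> (\<integral>x. f x \<partial>equilibrium_measure)"
proof (rule LIMSEQ_I)
  fix e :: real assume e: "0 < e"
  obtain g where g: "real_polynomial_function g" "\<And>x. x \<in> cube \<Longrightarrow> \<bar>f x - g x\<bar> < e / 3"
    using Stone_Weierstrass_real_polynomial_function[OF compact_cube f, of "e / 3"] e by auto
  then obtain p where p: "g = mpoly_eval p"
    using real_polynomial_function_mpoly by blast
  have close: "\<bar>(\<integral>x. f x \<partial>\<phi>) - (\<integral>x. mpoly_eval p x \<partial>\<phi>)\<bar> \<le> e / 3"
    if "\<phi> \<in> borel_prob_measures cube" for \<phi>
    using g(2) p by (intro integral_diff_le that f continuous_intros) (auto intro: less_imp_le)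
  show "\<exists>N. \<forall>n\<ge>N. norm ((\<integral>x. f x \<partial>gauss_chebyshev_prod n) - (\<integral>x. f x \<partial>equilibrium_measure)) < e"
  proof (intro exI allI impI)
    fix n assume "total_degree p \<le> n"
    then have "(\<integral>x. mpoly_eval p x \<partial>gauss_chebyshev_prod n) = (\<integral>x. mpoly_eval p x \<partial>equilibrium_measure)"
      by (intro gauss_chebyshev_prod_exact) simp
    with close[OF gauss_chebyshev_prod_in[of n]]
    have "\<bar>(\<integral>x. f x \<partial>gauss_chebyshev_prod n) - (\<integral>x. mpoly_eval p x \<partial>equilibrium_measure)\<bar> \<le> e / 3"
      by (simp only:)
    then show "norm ((\<integral>x. f x \<partial>gauss_chebyshev_prod n) - (\<integral>x. f x \<partial>equilibrium_measure)) < e"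
      using close[OF equilibrium_measure_in] e unfolding real_norm_def by linarith
  qed
qed


section \<open>Optimality and weak-star limit\<close>

theorem corollary1:
  shows "(\<forall>n. is_arg_max (logdet_objective n) (\<lambda>\<phi>. \<phi> \<in> borel_prob_measures cube)
              (gauss_chebyshev_prod n :: (real^'d::finite) measure)) \<and>
         (\<forall>f :: real^'d \<Rightarrow> real. continuous_on cube f \<longrightarrow>
            (\<lambda>n. \<integral>x. f x \<partial>gauss_chebyshev_prod n) \<longlonglongrightarrow> (\<integral>x. f x \<partial>equilibrium_measure))"
  by (auto simp: is_arg_max_def not_less gauss_chebyshev_prod_in logdet_objective_le
      gauss_chebyshev_prod_weak_limit)

end
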